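(* Let $1\le p<+\infty$, let $X$ be a finite dimensional Hilbert space over $\mathbb K\in\{\mathbb R,\mathbb C\}$, let $\mathcal S=(S_n)_{n\in\mathbb Z}$ be a sequence of invertible linear operators on $X$ for which there is $C_0>0$ with $\|S_n\|,\|S_n^{-1}\|<C_0$ for all $n\in\mathbb Z$, and assume that $\mathcal E$ is a basis of $X$ with $\mathcal S$-bounded projections. Then $\sigma_{\mathcal S}\colon\ell_p(X)\to\ell_p(X)$ has the shadowing property if and only if for every $x\in\mathcal E$ one of the following conditions holds: (A) $$\lim_{n\to+\infty}\left(\max\left\{\sup_{k\in\mathbb N}\frac{\|(S_{[1,k-1]})^{-1}(x)\|}{\|(S_{[1,k+n]})^{-1}(x)\|},\ \sup_{k\ge n}\frac{\|S_{[-k,0]}(x)\|}{\|S_{[-k+n,0]}(x)\|},\ \sup_{0\le k<n}\frac{\|S_{[-k,0]}(x)\|}{\|(S_{[1,-k+n]})^{-1}(x)\|}\right\}\right)^{1/n}<1;$$ (B) $$\lim_{n\to+\infty}\left(\min\left\{\inf_{k\in\mathbb N}\frac{\|(S_{[1,k-1]})^{-1}(x)\|}{\|(S_{[1,k+n]})^{-1}(x)\|},\ \inf_{k\ge n}\frac{\|S_{[-k,0]}(x)\|}{\|S_{[-k+n,0]}(x)\|},\ \inf_{0\le k<n}\frac{\|S_{[-k,0]}(x)\|}{\|(S_{[1,-k+n]})^{-1}(x)\|}\right\}\right)^{1/n}>1;$$ (C) $$\lim_{n\to+\infty}\sup_{k\in\mathbb N}\left(\frac{\|S_{[-k-n,0]}(x)\|}{\|S_{[-k+1,0]}(x)\|}\right)^{1/n}<1\quad\text{and}\quad\lim_{n\to+\infty}\inf_{k\in\mathbb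 N}\left(\frac{\|(S_{[1,k-1]})^{-1}(x)\|}{\|(S_{[1,k+n]})^{-1}(x)\|}\right)^{1/n}>1.$$
   Context: $\mathbb N=\{1,2,\dots\}$. $\ell_p(X)$ is the Banach space of bilateral sequences $(y_n)_{n\in\mathbb Z}$ in $X$ with $\|(y_n)\|_p=(\sum_{n\in\mathbb Z}\|y_n\|^p)^{1/p}<\infty$. Shift operator: $\sigma_{\mathcal S}((x_n)_{n\in\mathbb Z})=(S_{n+1}(x_{n+1}))_{n\in\mathbb Z}$. For $n,m\in\mathbb Z$ let $S_{[n,m]}=S_n\circ S_{n+1}\circ\cdots\circ S_m$ if $n<m$, $S_{[n,n]}=S_n$, and $S_{[n,m]}=\mathrm{Id}$ if $n>m$; thus $(S_{[1,m]})^{-1}=S_m^{-1}\cdots S_1^{-1}$ for $m\ge1$. For $x\in X\setminus\{0\}$ define the unit vectors $$e_n(x)=\frac{(S_{[1,n]})^{-1}(x)}{\|(S_{[1,n]})^{-1}(x)\|}\ (n\ge0),\qquad e_n(x)=\frac{S_{[n+1,0]}(x)}{\|S_{[n+1,0]}(x)\|}\ (n<0).$$ $\mathcal S$-bounded projections: for a basis $\mathcal E$ of $X$ put $\mathcal E_n=\{e_n(x)\colon x\in\mathcal E\}$, which is a basis of $X$ for each $n\in\mathbb Z$. For $b\in\mathcal E_n$ let $\Pi_b\colon X\to\mathrm{span}\{b\}$, $\Pi_b(\sum_{c\in\mathcal E_n}\alpha_c c)=\alpha_b b$. The basis $\mathcal E$ has $\mathcal S$-bounded projections if $\sup_{n\in\mathbb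 Z}\sup_{b\in\mathcal E_n}\|\Pi_b\|<+\infty$. A bounded invertible linear operator $T$ on a Banach space $Y$ has the shadowing property if there is $K>0$ such that for every bounded sequence $(z_n)_{n\in\mathbb Z}$ in $Y$ there is a bounded sequence $(x_n)_{n\in\mathbb Z}$ in $Y$ with $x_{n+1}-T(x_n)=z_n$ for all $n$ and $\sup_n\|x_n\|\le K\sup_n\|z_n\|$. *)

theory Defs
  imports "HOL-Analysis.Analysis"
begin

text \<open>
  The class of scalar fields: up to isometric isomorphism, its instances are exactly the real and
  the complex numbers. The embedding into the complex numbers serves to speak about
  conjugation of scalars uniformly in both cases.
\<close>

class real_or_complex = real_normed_field +
  fixes to_complex :: "'a \<Rightarrow> complex"
  assumes to_complex_add: "to_complex (a + b) = to_complex a + to_complex b"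
    and to_complex_mult: "to_complex (a * b) = to_complex a * to_complex b"
    and to_complex_one: "to_complex 1 = 1"
    and norm_to_complex: "cmod (to_complex a) = norm a"
    and range_to_complex: "range to_complex = \<real> \<or> range to_complex = UNIV"

instantiation real :: real_or_complex
begin

definition to_complex_real :: "real \<Rightarrow> complex"
  where "to_complex_real = complex_of_real"

instance
  by standard (auto simp: to_complex_real_def Reals_def)

end

instantiation complex :: real_or_complex
begin

definition to_complex_complex :: "complex \<Rightarrow> complex"
  where "to_complex_complex = (\<lambda>z. z)"

instance
  by standard (auto simp: to_complex_complex_def)

end

text \<open>
  The norm and the real scalar multiplication of the type class are required to be those of the
  Hilbert space. Completeness is automatic in finite dimension.
\<close>

locale fin_dim_hilbert_space = vector_space cscale
  for cscale :: "'k::real_or_complex \<Rightarrow> 'x::real_normed_vector \<Rightarrow> 'x" +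
  fixes ip :: "'x \<Rightarrow> 'x \<Rightarrow> 'k"
  assumes scale_of_real: "cscale (of_real r) x = r *\<^sub>R x"
    and ip_add_left: "ip (x + y) z = ip x z + ip y z"
    and ip_scale_left: "ip (cscale a x) y = a * ip x y"
    and ip_conj_sym: "to_complex (ip y x) = cnj (to_complex (ip x y))"
    and ip_self: "ip x x = of_real ((norm x)\<^sup>2)"
    and fin_dim: "\<exists>B. finite B \<and> span B = UNIV"

lemma fin_dim_hilbert_space_euclidean:
  "fin_dim_hilbert_space (scaleR :: real \<Rightarrow> 'a \<Rightarrow> 'a::euclidean_space) inner"
proof -
  have v: "vector_space (scaleR :: real \<Rightarrow> 'a \<Rightarrow> 'a)"
    by unfold_locales
  have "\<exists>B::'a set. finite B \<and> module.span scaleR B = UNIV"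
    using span_Basis finite_Basis unfolding span_raw_def by blast
  then show ?thesis
    by (intro fin_dim_hilbert_space.intro fin_dim_hilbert_space_axioms.intro v)
      (auto simp: inner_add_left to_complex_real_def power2_norm_eq_inner intro: inner_commute)
qed

lemma fin_dim_hilbert_space_complex_vec:
  "fin_dim_hilbert_space ((*s) :: complex \<Rightarrow> complex ^ 'n \<Rightarrow> complex ^ 'n)
     (\<lambda>x y. \<Sum>i\<in>UNIV. x $ i * cnj (y $ i))"
proof -
  have n: "(\<Sum>i\<in>UNIV. x $ i * cnj (x $ i)) = of_real ((norm x)\<^sup>2)" for x :: "complex ^ 'n"
    by (simp add: norm_vec_def L2_set_def sum_nonneg complex_norm_square[symmetric]
        del: of_real_power)
  show ?thesis
    by (intro fin_dim_hilbert_space.intro fin_dim_hilbert_space_axioms.intro vec.vector_space_axioms n)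
      (auto simp: vec_eq_iff scaleR_conv_of_real[where 'a = complex] ring_distribs sum.distrib sum_distrib_left
        to_complex_complex_def mult_ac intro!: exI[of _ cart_basis] finite_cart_basis)
qed

definition is_basis :: "('k::field \<Rightarrow> 'x::ab_group_add \<Rightarrow> 'x) \<Rightarrow> 'x set \<Rightarrow> bool"
  where "is_basis cscale E \<longleftrightarrow> \<not> module.dependent cscale E \<and> module.span cscale E = UNIV"

text \<open>The coordinate projection onto the span of \<open>b\<close> along the other vectors of the basis \<open>B\<close>.\<close>

definition basis_proj :: "('k::field \<Rightarrow> 'x::ab_group_add \<Rightarrow> 'x) \<Rightarrow> 'x set \<Rightarrow> 'x \<Rightarrow> 'x \<Rightarrow> 'x"
  where "basis_proj cscale B b x = cscale (module.representation cscale B x b) b"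

definition lp :: "real \<Rightarrow> (int \<Rightarrow> 'x::real_normed_vector) set"
  where "lp p = {y. (\<lambda>n. norm (y n) powr p) summable_on UNIV}"

definition lp_norm :: "real \<Rightarrow> (int \<Rightarrow> 'x::real_normed_vector) \<Rightarrow> real"
  where "lp_norm p y = (\<Sum>\<^sub>\<infinity>n. norm (y n) powr p) powr (1 / p)"

definition shift_op :: "(int \<Rightarrow> 'x \<Rightarrow> 'x) \<Rightarrow> (int \<Rightarrow> 'x) \<Rightarrow> (int \<Rightarrow> 'x)"
  where "shift_op S x = (\<lambda>n. S (n + 1) (x (n + 1)))"

text \<open>
  The shadowing property of an operator \<open>T\<close> on the Banach space with carrier \<open>Y\<close> and norm \<open>nrm\<close>.
\<close>

definition bounded_seq_in :: "'y set \<Rightarrow> ('y \<Rightarrow> real) \<Rightarrow> (int \<Rightarrow> 'y) \<Rightarrow> bool"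
  where "bounded_seq_in Y nrm z \<longleftrightarrow> range z \<subseteq> Y \<and> bdd_above (range (\<lambda>n. nrm (z n)))"

definition shadowing_property :: "'y::minus set \<Rightarrow> ('y \<Rightarrow> real) \<Rightarrow> ('y \<Rightarrow> 'y) \<Rightarrow> bool"
  where "shadowing_property Y nrm T \<longleftrightarrow>
    (\<exists>K>0. \<forall>z. bounded_seq_in Y nrm z \<longrightarrow>
      (\<exists>x. bounded_seq_in Y nrm x \<and> (\<forall>n. x (n + 1) - T (x n) = z n) \<and>
           (SUP n. nrm (x n)) \<le> K * (SUP n. nrm (z n))))"

text \<open>\<open>S n \<circ> S (n + 1) \<circ> \<dots> \<circ> S m\<close>, which is the identity for \<open>n > m\<close>.\<close>

definition op_prod :: "(int \<Rightarrow> 'x \<Rightarrow> 'x) \<Rightarrow> int \<Rightarrow> int \<Rightarrow> 'x \<Rightarrow> 'x"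
  where "op_prod S n m = foldr (\<lambda>i f. S i \<circ> f) [n..m] id"

definition e_vec :: "(int \<Rightarrow> 'x \<Rightarrow> 'x) \<Rightarrow> int \<Rightarrow> 'x \<Rightarrow> 'x::real_normed_vector"
  where "e_vec S n x =
    (if n \<ge> 0 then inv (op_prod S 1 n) x /\<^sub>R norm (inv (op_prod S 1 n) x)
     else op_prod S (n + 1) 0 x /\<^sub>R norm (op_prod S (n + 1) 0 x))"

definition has_bounded_projections ::
  "('k::field \<Rightarrow> 'x::real_normed_vector \<Rightarrow> 'x) \<Rightarrow> (int \<Rightarrow> 'x \<Rightarrow> 'x) \<Rightarrow> 'x set \<Rightarrow> bool"
  where "has_bounded_projections cscale S E \<longleftrightarrow>
    (\<exists>M. \<forall>n. \<forall>b \<in> e_vec S n ` E. onorm (basis_proj cscale (e_vec S n ` E) b) \<le> M)"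

text \<open>
  In the following conditions, an inequality for a limit includes the existence of the limit.
  The values of the sequences at \<open>n = 0\<close> are irrelevant. All suprema and infima are over nonempty
  sets of reals for \<open>n \<ge> 1\<close>, and they are bounded if the norms of all \<open>S n\<close> and their inverses are.
\<close>

definition condA :: "(int \<Rightarrow> 'x \<Rightarrow> 'x) \<Rightarrow> 'x::real_normed_vector \<Rightarrow> bool"
  where "condA S x \<longleftrightarrow>
    (\<exists>L<1. (\<lambda>n::nat.
      (Max {SUP k\<in>{1::int..}. norm (inv (op_prod S 1 (k - 1)) x) / norm (inv (op_prod S 1 (k + int n)) x),
            SUP k\<in>{int n..}. norm (op_prod S (- k) 0 x) / norm (op_prod S (- k + int n) 0 x),
            SUP k\<in>{0..<int n}. norm (op_prod S (- k) 0 x) / norm (inv (op_prod S 1 (- k + int n)) x)})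
      powr (1 / real n)) \<longlonglongrightarrow> L)"

definition condB :: "(int \<Rightarrow> 'x \<Rightarrow> 'x) \<Rightarrow> 'x::real_normed_vector \<Rightarrow> bool"
  where "condB S x \<longleftrightarrow>
    (\<exists>L>1. (\<lambda>n::nat.
      (Min {INF k\<in>{1::int..}. norm (inv (op_prod S 1 (k - 1)) x) / norm (inv (op_prod S 1 (k + int n)) x),
            INF k\<in>{int n..}. norm (op_prod S (- k) 0 x) / norm (op_prod S (- k + int n) 0 x),
            INF k\<in>{0..<int n}. norm (op_prod S (- k) 0 x) / norm (inv (op_prod S 1 (- k + int n)) x)})
      powr (1 / real n)) \<longlonglongrightarrow> L)"

definition condC :: "(int \<Rightarrow> 'x \<Rightarrow> 'x) \<Rightarrow> 'x::real_normed_vector \<Rightarrow> bool"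
  where "condC S x \<longleftrightarrow>
    (\<exists>L<1. (\<lambda>n::nat. SUP k\<in>{1::int..}.
        (norm (op_prod S (- k - int n) 0 x) / norm (op_prod S (- k + 1) 0 x)) powr (1 / real n))
      \<longlonglongrightarrow> L) \<and>
    (\<exists>L>1. (\<lambda>n::nat. INF k\<in>{1::int..}.
        (norm (inv (op_prod S 1 (k - 1)) x) / norm (inv (op_prod S 1 (k + int n)) x)) powr (1 / real n))
      \<longlonglongrightarrow> L)"

end

theory Submission
  imports Defs
begin

text \<open>
  Let \<open>v\<^sub>n\<close> be the orbit of a basis vector \<open>x\<close>, that is \<open>v\<^sub>0 = x\<close> and \<open>S\<^sub>n v\<^sub>n = v\<^sub>n\<^sub>-\<^sub>1\<close>, so that
  \<open>e\<^sub>n(x) = v\<^sub>n / \<parallel>v\<^sub>n\<parallel>\<close>. In coordinates along these orbits the shift moves the coefficient of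
  \<open>v\<^sub>n\<close> to \<open>v\<^sub>n\<^sub>-\<^sub>1\<close> without changing it. Hence the equations \<open>x\<^sub>t\<^sub>+\<^sub>1 - T x\<^sub>t = z\<^sub>t\<close> decouple
  completely: if \<open>f(n)\<close> is the coefficient along \<open>v\<^sub>n\<close> of the entry \<open>n\<close> of \<open>x\<^sub>d\<^sub>-\<^sub>n\<close>, then for each basis
  vector and each \<open>d\<close> only \<open>f(n) - f(n + 1) = c(n)\<close> has to be solved, where \<open>c(n)\<close> is the
  coefficient of \<open>z\<^sub>d\<^sub>-\<^sub>1\<^sub>-\<^sub>n\<close> at \<open>n\<close>. What matters is the growth of the scalar
  sequence \<open>a(n) = \<parallel>v\<^sub>n\<parallel>\<close>: by the bounded projections, \<open>\<bar>c(n)\<bar> a(n)\<close> is controlled by the norms of the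
  errors and \<open>\<bar>f(n)\<bar> a(n)\<close> has to be bounded.

  The three conditions say that \<open>a\<close> increases exponentially on \<open>\<int>\<close>, that it decreases
  exponentially on \<open>\<int>\<close>, or that it increases on the negative and decreases on the nonnegative
  integers. Translating them is a matter of quasi-submultiplicative
  sequences (\<open>fekete\<close>, \<open>root_sup_limit_iff\<close>, \<open>root_inf_limit_iff\<close>): the quantities
  under the roots differ only by bounded factors from the extreme ratios \<open>a(j) / a(j + n)\<close> over the
  windows of length \<open>n\<close>.

  Suppose that the shadowing property holds. Take as the error \<open>z\<^sub>t\<close> the unit vector \<open>e\<^sub>n(x)\<close> at the single
  entry \<open>n = -1 - t\<close>. Then \<open>f(n) - f(n + 1) = 1 / a(n)\<close> and \<open>\<bar>f(n)\<bar> \<le> K / a(n)\<close>; summing, the sum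
  of \<open>1 / a\<close> over any window is at most a constant times the sum of its two end values
  (\<open>sum_le_endpoints_if_shadowing\<close>). This convexity property alone forces one of the three growth patterns
  (\<open>exponential_trichotomy\<close>).

  Conversely, suppose that the growth conditions hold. Then \<open>f\<close> is given by a Green function: \<open>f(n)\<close> is the
  sum of \<open>c(j)\<close> over \<open>j \<ge> n\<close> in \<open>P\<close> minus its sum over \<open>j < n\<close> outside \<open>P\<close>, where \<open>P\<close> is \<open>\<int>\<close>, empty,
  or the set of negative integers in the three cases (\<open>green_solution_solves\<close>,
  \<open>green_kernel_of_exponential\<close>). The growth of \<open>a\<close> makes the kernel exponentially localized, and
  convolution with a geometric kernel is bounded on \<open>\<ell>\<^sub>p\<close> (\<open>lp_norm_geometric_convolution\<close>).
\<close>

section \<open>Exponential growth of scalar sequences\<close>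

text \<open>
  Both ends of a window are restricted to \<open>U\<close>: growth on two half-lines separately says nothing about the windows
  that contain the origin, as the mixed pattern requires.
\<close>

definition exp_increasing_on :: "int set \<Rightarrow> (int \<Rightarrow> real) \<Rightarrow> bool"
  where "exp_increasing_on U a \<longleftrightarrow> (\<exists>C q. 0 < q \<and> q < 1 \<and>
    (\<forall>j n. j \<in> U \<longrightarrow> j + int n \<in> U \<longrightarrow> a j \<le> C * q ^ n * a (j + int n)))"

definition exp_decreasing_on :: "int set \<Rightarrow> (int \<Rightarrow> real) \<Rightarrow> bool"
  where "exp_decreasing_on U a \<longleftrightarrow> (\<exists>C q. 0 < q \<and> q < 1 \<and>
    (\<forall>j n. j \<in> U \<longrightarrow> j + int n \<in> U \<longrightarrow> a (j + int n) \<le> C * q ^ n * a j))"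

lemma exp_decreasing_reflect:
  "exp_decreasing_on U a \<longleftrightarrow> exp_increasing_on {j. - j \<in> U} (\<lambda>j. a (- j))"
proof
  assume "exp_decreasing_on U a"
  then obtain C q where q: "0 < q" "q < 1"
    and h: "\<And>j n. j \<in> U \<Longrightarrow> j + int n \<in> U \<Longrightarrow> a (j + int n) \<le> C * q ^ n * a j"
    unfolding exp_decreasing_on_def by blast
  have "a (- j) \<le> C * q ^ n * a (- (j + int n))" if "- j \<in> U" "- (j + int n) \<in> U" for j n
    using h[of "- (j + int n)" n] that by simp
  then show "exp_increasing_on {j. - j \<in> U} (\<lambda>j. a (- j))"
    unfolding exp_increasing_on_def using q by blast
next
  assume "exp_increasing_on {j. - j \<in> U} (\<lambda>j. a (- j))"
  then obtain C q where q: "0 < q" "q < 1"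
    and h: "\<And>j n. - j \<in> U \<Longrightarrow> - (j + int n) \<in> U \<Longrightarrow> a (- j) \<le> C * q ^ n * a (- (j + int n))"
    unfolding exp_increasing_on_def by blast
  have "a (j + int n) \<le> C * q ^ n * a j" if "j \<in> U" "j + int n \<in> U" for j n
    using h[of "- (j + int n)" n] that by (simp add: add.commute)
  then show "exp_decreasing_on U a"
    unfolding exp_decreasing_on_def using q by blast
qed

lemma exp_increasing_inverse:
  assumes "\<And>j. 0 < a j"
  shows "exp_increasing_on U (\<lambda>j. 1 / a j) \<longleftrightarrow> exp_decreasing_on U a"
  unfolding exp_increasing_on_def exp_decreasing_on_def using assms
  by (simp add: field_simps)

lemma exp_decreasing_inverse:
  assumes "\<And>j. 0 < a j"
  shows "exp_decreasing_on U (\<lambda>j. 1 / a j) \<longleftrightarrow> exp_increasing_on U a"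
  unfolding exp_increasing_on_def exp_decreasing_on_def using assms
  by (simp add: field_simps)

text \<open>
  The last term is at least the fraction \<open>1 / K\<close> of the partial sum \<open>s\<^sub>n\<close>, so the partial sums grow at least
  by the factor \<open>K / (K - 1)\<close> in each step; then \<open>B m \<le> s\<^sub>m\<close> is far below \<open>s\<^sub>m\<^sub>+\<^sub>n \<le> K * B (m + n)\<close>.
  The slightly weaker rate \<open>(K + 1) / K\<close> avoids the degenerate case \<open>K = 1\<close>.
\<close>

lemma geometric_growth_of_sum_le_last:
  fixes B :: "nat \<Rightarrow> real"
  assumes pos: "\<And>n. 0 < B n" and K: "\<And>n. (\<Sum>j\<le>n. B j) \<le> K * B n"
  shows "B m \<le> K * (K / (K + 1)) ^ n * B (m + n)"
proof -
  define s where "s n = (\<Sum>j\<le>n. B j)" for n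
  define q where "q = K / (K + 1)"
  have "B 0 \<le> K * B 0" using K[of 0] by simp
  then have K1: "1 \<le> K" using pos[of 0] by simp
  have q0: "0 \<le> q" using K1 by (simp add: q_def)
  have step: "s n \<le> q * s (Suc n)" for n
  proof -
    have le: "s (Suc n) \<le> K * B (Suc n)" using K[of "Suc n"] by (simp add: s_def)
    have eq: "s (Suc n) = s n + B (Suc n)" by (simp add: s_def)
    have "s n \<le> K * B (Suc n)" using le eq pos[of "Suc n"] by linarith
    then have "(K + 1) * s n \<le> K * s (Suc n)" unfolding eq by (simp add: algebra_simps)
    then show ?thesis using K1 by (simp add: q_def field_simps)
  qed
  have "s m \<le> q ^ n * s (m + n)"
  proof (induction n)
    case (Suc n)
    have "q ^ n * s (m + n) \<le> q ^ n * (q * s (Suc (m + n)))"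
      using step q0 by (intro mult_left_mono) auto
    then show ?case using Suc by (simp add: mult_ac)
  qed simp
  moreover have "B m \<le> s m"
    unfolding s_def using pos by (intro member_le_sum) (auto intro: less_imp_le)
  moreover have "q ^ n * s (m + n) \<le> q ^ n * (K * B (m + n))"
    using K q0 by (intro mult_left_mono) (auto simp: s_def)
  ultimately show ?thesis by (simp add: q_def mult_ac)
qed

lemma sum_int_atLeastAtMost_shift:
  fixes A :: "int \<Rightarrow> real"
  shows "(\<Sum>j\<in>{m..m + int n}. A j) = (\<Sum>i\<le>n. A (m + int i))"
  by (rule sum.reindex_bij_witness[of _ "\<lambda>i. m + int i" "\<lambda>j. nat (j - m)"]) auto

lemma sum_int_atLeastAtMost_shift_rev:
  fixes A :: "int \<Rightarrow> real"
  shows "(\<Sum>j\<in>{m - int n..m}. A j) = (\<Sum>i\<le>n. A (m - int i))"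
  by (rule sum.reindex_bij_witness[of _ "\<lambda>i. m - int i" "\<lambda>j. nat (m - j)"]) auto

text \<open>
  The alternative is whether the sums of \<open>A\<close> to the right stay bounded. If they do, then \<open>A\<close> tends to 0 there,
  the right end value drops out of the hypothesis, and every window is dominated by its left end: read
  from right to left, every window grows geometrically, with constants that do not depend on the
  window. If they do not, then the fixed left end value \<open>A 0\<close> is eventually absorbed, and
  the partial sums from 0 on are dominated by their last term.
\<close>

lemma forward_dichotomy:
  fixes A :: "int \<Rightarrow> real"
  assumes pos: "\<And>j. 0 < A j"
    and K: "\<And>m n. m \<le> n \<Longrightarrow> (\<Sum>j\<in>{m..n}. A j) \<le> K * (A m + A n)"
  shows "exp_decreasing_on UNIV A \<or> exp_increasing_on {0..} A"
proof -
  define s where "s n = (\<Sum>i\<le>n. A (int i))" for n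
  have s_eq: "s n = (\<Sum>j\<in>{0..int n}. A j)" for n
    using sum_int_atLeastAtMost_shift[of A 0 n] by (simp add: s_def)
  have sK: "s n \<le> K * (A 0 + A (int n))" for n
    unfolding s_eq by (rule K) simp
  have "A 0 \<le> K * (A 0 + A 0)" using sK[of 0] by (simp add: s_def)
  then have K0: "0 < K" using pos[of 0]
    by (metis add_pos_pos linorder_not_le mult_nonpos_nonneg less_imp_le order.strict_trans2 not_less_iff_gr_or_eq)
  have s_mono: "s m \<le> s n" if "m \<le> n" for m n
    unfolding s_def using that pos by (intro sum_mono2) (auto intro: less_imp_le)
  have s_pos: "0 < s n" for n
    unfolding s_def by (intro sum_pos) (auto simp: pos)
  show ?thesis
  proof (cases "\<exists>N. 2 * K * A 0 \<le> s N")
    case True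
    then obtain N where N: "2 * K * A 0 \<le> s N" ..
    \<comment> \<open>Beyond \<open>N\<close> the constant \<open>2 * K\<close> suffices; the second summand covers the finitely many earlier partial sums.\<close>
    define K' where "K' = 2 * K + (\<Sum>i<N. s i / A (int i))"
    have part_nonneg: "0 \<le> (\<Sum>i<N. s i / A (int i))"
      using pos s_pos by (intro sum_nonneg) (auto intro: less_imp_le)
    have "s n \<le> K' * A (int n)" for n
    proof (cases "N \<le> n")
      case True
      have "2 * K * A 0 \<le> s n" using N s_mono[OF True] by linarith
      then have "s n \<le> 2 * K * A (int n)" using sK[of n] by (simp add: algebra_simps)
      also have "\<dots> \<le> K' * A (int n)"
        using pos[of "int n"] part_nonneg by (intro mult_right_mono) (auto simp: K'_def)
      finally show ?thesis .
    next
      case False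
      have "s n / A (int n) \<le> (\<Sum>i<N. s i / A (int i))"
        using False pos s_pos by (intro member_le_sum) (auto intro: less_imp_le)
      then have "s n / A (int n) \<le> K'" using K0 by (simp add: K'_def)
      then show ?thesis using pos[of "int n"] by (simp add: field_simps)
    qed
    then have le: "A (int m) \<le> K' * (K' / (K' + 1)) ^ n * A (int (m + n))" for m n
      by (intro geometric_growth_of_sum_le_last) (auto simp: pos s_def)
    have K': "0 < K'" using K0 part_nonneg by (simp add: K'_def)
    have "A j \<le> K' * (K' / (K' + 1)) ^ n * A (j + int n)" if "0 \<le> j" for j n
      using le[of "nat j" n] that by simp
    moreover have "0 < K' / (K' + 1)" "K' / (K' + 1) < 1" using K' by auto
    ultimately have "exp_increasing_on {0..} A"
      unfolding exp_increasing_on_def by (metis atLeast_iff)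
    then show ?thesis ..
  next
    case False
    have "summable (\<lambda>i. A (int i))"
    proof (rule bounded_imp_summable)
      show "0 \<le> A (int n)" for n using pos[of "int n"] by simp
      show "(\<Sum>k\<le>n. A (int k)) \<le> 2 * K * A 0" for n
        using False by (auto simp: s_def not_le intro: less_imp_le)
    qed
    then have lim: "(\<lambda>i. A (int i)) \<longlonglongrightarrow> 0" by (rule summable_LIMSEQ_zero)
    have tail: "(\<Sum>j\<in>{m..n}. A j) \<le> K * A m" for m n
    proof (rule tendsto_lowerbound)
      show "(\<lambda>i. K * (A m + A (int i))) \<longlonglongrightarrow> K * A m"
        using lim by (auto intro!: tendsto_eq_intros)
      have "(\<Sum>j\<in>{m..n}. A j) \<le> K * (A m + A (int i))" if "nat (max m n) \<le> i" for i
      proof -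
        have "(\<Sum>j\<in>{m..n}. A j) \<le> (\<Sum>j\<in>{m..int i}. A j)"
          using that pos by (intro sum_mono2) (auto intro: less_imp_le)
        also have "\<dots> \<le> K * (A m + A (int i))" using that by (intro K) auto
        finally show ?thesis .
      qed
      then show "\<forall>\<^sub>F i in sequentially. (\<Sum>j\<in>{m..n}. A j) \<le> K * (A m + A (int i))"
        by (auto simp: eventually_sequentially)
    qed simp
    have "A (j + int n) \<le> K * (K / (K + 1)) ^ n * A j" for j n
    proof -
      have "(\<Sum>i\<le>k. A (j + int n - int i)) \<le> K * A (j + int n - int k)" for k
        using tail[of "j + int n - int k" "j + int n"]
        by (simp add: sum_int_atLeastAtMost_shift_rev)
      from geometric_growth_of_sum_le_last[of "\<lambda>i. A (j + int n - int i)" K 0 n, OF pos this]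
      show ?thesis by simp
    qed
    moreover have "0 < K / (K + 1)" "K / (K + 1) < 1" using K0 by auto
    ultimately have "exp_decreasing_on UNIV A"
      unfolding exp_decreasing_on_def by blast
    then show ?thesis ..
  qed
qed

lemma exp_increasing_on_subset:
  "exp_increasing_on V a \<Longrightarrow> U \<subseteq> V \<Longrightarrow> exp_increasing_on U a"
  unfolding exp_increasing_on_def by blast

text \<open>
  The dichotomy applies in both directions. A decreasing alternative of one of them already settles the matter, and if
  both directions give growth away from the origin, then \<open>A\<close> has the shape of a valley. A peak is
  excluded: there the window sum would exceed the end values.
\<close>

lemma exponential_trichotomy:
  fixes A :: "int \<Rightarrow> real"
  assumes pos: "\<And>j. 0 < A j"
    and K: "\<And>m n. m \<le> n \<Longrightarrow> (\<Sum>j\<in>{m..n}. A j) \<le> K * (A m + A n)"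
  shows "exp_decreasing_on UNIV A \<or> exp_increasing_on UNIV A \<or>
    exp_decreasing_on {..-1} A \<and> exp_increasing_on {0..} A"
proof -
  have "(\<Sum>j\<in>{m..n}. A (- j)) \<le> K * (A (- m) + A (- n))" if "m \<le> n" for m n
  proof -
    have "(\<Sum>j\<in>{m..n}. A (- j)) = (\<Sum>j\<in>{- n..- m}. A j)"
      by (rule sum.reindex_bij_witness[of _ uminus uminus]) auto
    also have "\<dots> \<le> K * (A (- n) + A (- m))" using that by (intro K) simp
    finally show ?thesis by (simp add: add.commute)
  qed
  then have refl: "exp_decreasing_on UNIV (\<lambda>j. A (- j)) \<or> exp_increasing_on {0..} (\<lambda>j. A (- j))"
    by (intro forward_dichotomy) (auto simp: pos)
  have "exp_decreasing_on UNIV (\<lambda>j. A (- j)) \<longleftrightarrow> exp_increasing_on UNIV A"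
    using exp_decreasing_reflect[of UNIV "\<lambda>j. A (- j)"] by simp
  moreover have "exp_increasing_on {j. - j \<in> {..-1}} (\<lambda>j. A (- j))"
    if "exp_increasing_on {0..} (\<lambda>j. A (- j))"
    by (rule exp_increasing_on_subset[OF that]) auto
  ultimately show ?thesis
    using refl forward_dichotomy[OF pos K] exp_decreasing_reflect[of "{..-1}" A] by blast
qed

section \<open>Growth of windows and limits of roots\<close>

text \<open>
  Subadditivity gives \<open>h n \<le> k * h m + h s\<close> for \<open>n = k * m + s\<close>, so \<open>h n / n\<close> is eventually below
  \<open>h m / m + \<epsilon>\<close> for every \<open>m\<close>: the limit is the infimum.
\<close>

lemma fekete:
  fixes h :: "nat \<Rightarrow> real"
  assumes sub: "\<And>m n. 1 \<le> m \<Longrightarrow> 1 \<le> n \<Longrightarrow> h (m + n) \<le> h m + h n"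
    and bdd: "\<And>n. 1 \<le> n \<Longrightarrow> b \<le> h n / real n"
  shows "\<exists>l. (\<lambda>n. h n / real n) \<longlonglongrightarrow> l"
proof -
  define l where "l = (INF n\<in>{1..}. h n / real n)"
  have bb: "bdd_below ((\<lambda>n. h n / real n) ` {1..})"
    by (rule bdd_belowI2[of _ b]) (use bdd in auto)
  have l_le: "l \<le> h n / real n" if "1 \<le> n" for n
    unfolding l_def using bb that by (intro cINF_lower) auto
  have mult: "h (k * m + s) \<le> real k * h m + h s" if "1 \<le> m" "1 \<le> s" for k m s
  proof (induction k)
    case (Suc k)
    have "h (m + (k * m + s)) \<le> h m + h (k * m + s)" using that by (intro sub) auto
    then show ?case using Suc by (simp add: algebra_simps)
  qed simp
  have "(\<lambda>n. h n / real n) \<longlonglongrightarrow> l"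
  proof (rule LIMSEQ_I)
    fix e :: real assume e: "0 < e"
    have "\<exists>m\<in>{1..}. h m / real m < l + e / 2"
      using cINF_less_iff[OF _ bb, of "l + e / 2"] e by (auto simp: l_def)
    then obtain m where m: "1 \<le> m" "h m / real m < l + e / 2" by auto
    define B where "B = (\<Sum>s\<le>m. \<bar>h s\<bar>)"
    define R where "R = \<bar>h m\<bar> + B"
    obtain N where N: "2 * R / e < real N" using reals_Archimedean2 by blast
    have B_ge: "\<bar>h s\<bar> \<le> B" if "s \<le> m" for s
      unfolding B_def using that by (intro member_le_sum) auto
    have "norm (h n / real n - l) < e" if n: "n \<ge> Suc N" for n
    proof -
      \<comment> \<open>Subadditivity is available for positive arguments only, so the remainder is taken in \<open>{1..m}\<close>.\<close>
      define k where "k = (n - 1) div m"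
      define s where "s = (n - 1) mod m + 1"
      have s: "1 \<le> s" "s \<le> m" using m by (auto simp: s_def Suc_le_eq)
      have n_eq: "n = k * m + s" using n by (simp add: k_def s_def)
      have "real k * real m = real n - real s" by (simp add: n_eq)
      then have k_eq: "real k = (real n - real s) / real m" using m by (simp add: field_simps)
      have "h n \<le> real k * h m + h s" using mult[OF m(1) s(1), of k] by (simp add: n_eq)
      also have "\<dots> = real n * (h m / real m) + (h s - (real s / real m) * h m)"
        using m by (simp add: k_eq field_simps)
      also have "h s - (real s / real m) * h m \<le> R"
      proof -
        have "\<bar>(real s / real m) * h m\<bar> \<le> 1 * \<bar>h m\<bar>"
          unfolding abs_mult using s m by (intro mult_right_mono) auto
        then show ?thesis using B_ge[OF s(2)] unfolding R_def by linarith
      qed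
      finally have "h n \<le> real n * (h m / real m) + R" by simp
      then have "h n / real n \<le> (real n * (h m / real m) + R) / real n"
        by (intro divide_right_mono) auto
      also have "\<dots> = h m / real m + R / real n"
        using n by (simp add: add_divide_distrib)
      also have "R / real n < e / 2"
      proof -
        have "2 * R / e < real n" using N n by linarith
        then show ?thesis using e n by (simp add: field_simps)
      qed
      finally have "h n / real n < l + e" using m(2) by simp
      moreover have "l \<le> h n / real n" using l_le n by simp
      ultimately show ?thesis by simp
    qed
    then show "\<exists>no. \<forall>n\<ge>no. norm (h n / real n - l) < e" by blast
  qed
  then show ?thesis ..
qed

text \<open>
  The logarithm of \<open>D * r n ^ n\<close> is subadditive, and the constant \<open>D\<close> disappears in the limit.
\<close>

lemma root_converges_if_quasi_submultiplicative:
  fixes r :: "nat \<Rightarrow> real"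
  assumes c: "0 < c" "\<And>n. 1 \<le> n \<Longrightarrow> c \<le> r n"
    and D: "0 < D" "\<And>m n. 1 \<le> m \<Longrightarrow> 1 \<le> n \<Longrightarrow>
      r (m + n) ^ (m + n) \<le> D * r m ^ m * r n ^ n"
  shows "\<exists>L. r \<longlonglongrightarrow> L"
proof -
  define h where "h n = ln (D * r n ^ n)" for n
  have pos: "0 < r n" if "1 \<le> n" for n using c that by (meson less_le_trans)
  have h_eq: "h n = ln D + real n * ln (r n)" if "1 \<le> n" for n
    using D pos[OF that] by (simp add: h_def ln_mult ln_realpow)
  have "\<exists>l. (\<lambda>n. h n / real n) \<longlonglongrightarrow> l"
  proof (rule fekete)
    fix m n :: nat assume mn: "1 \<le> m" "1 \<le> n"
    have "D * r (m + n) ^ (m + n) \<le> D * (D * r m ^ m * r n ^ n)"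
      using D mn by (intro mult_left_mono) auto
    then have "D * r (m + n) ^ (m + n) \<le> (D * r m ^ m) * (D * r n ^ n)"
      by (simp add: mult_ac)
    moreover have "0 < D * r k ^ k" if "1 \<le> k" for k using D pos[OF that] by simp
    ultimately have "h (m + n) \<le> ln ((D * r m ^ m) * (D * r n ^ n))"
      unfolding h_def using mn by (subst ln_le_cancel_iff) auto
    also have "\<dots> = h m + h n"
      unfolding h_def using D mn[THEN pos] by (subst ln_mult) auto
    finally show "h (m + n) \<le> h m + h n" .
  next
    fix n :: nat assume n: "1 \<le> n"
    have "ln c \<le> ln (r n)" using c n by (subst ln_le_cancel_iff) (auto intro: pos)
    moreover have "- \<bar>ln D\<bar> \<le> ln D / real n"
    proof -
      have "\<bar>ln D / real n\<bar> \<le> \<bar>ln D\<bar>" using n mult_right_mono[of 1 "real n" "\<bar>ln D\<bar>"] by (simp add: field_simps)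
      then show ?thesis by linarith
    qed
    moreover have "h n / real n = ln D / real n + ln (r n)"
      using n by (simp add: h_eq field_simps)
    ultimately show "ln c - \<bar>ln D\<bar> \<le> h n / real n" by linarith
  qed
  then obtain l where l: "(\<lambda>n. h n / real n) \<longlonglongrightarrow> l" ..
  have "(\<lambda>n. exp (h n / real n - ln D / real n)) \<longlonglongrightarrow> exp (l - 0)"
    by (intro tendsto_intros l lim_const_over_n)
  moreover have "\<forall>\<^sub>F n in sequentially. exp (h n / real n - ln D / real n) = r n"
    using eventually_ge_at_top[of 1]
    by eventually_elim (simp add: h_eq pos add_divide_distrib)
  ultimately have "r \<longlonglongrightarrow> exp (l - 0)" by (rule Lim_transform_eventually)
  then show ?thesis ..
qed

text \<open>
  Neighbouring values are comparable. This makes windows of lengths \<open>n\<close> and \<open>n + 1\<close> equivalent up to a constant,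
  bounds the ratios over windows of a fixed length, and bounds the limits of roots away from 0 and \<open>\<infinity>\<close>.
\<close>

locale bounded_ratios =
  fixes a :: "int \<Rightarrow> real" and C :: real
  assumes pos: "\<And>j. 0 < a j"
    and le_next: "\<And>j. a j \<le> C * a (j + 1)"
    and next_le: "\<And>j. a (j + 1) \<le> C * a j"
begin

lemma C_ge_1: "1 \<le> C"
proof -
  have C0: "0 < C" using le_next[of 0] pos[of 0] pos[of 1]
    by (metis add_0 less_le_trans zero_less_mult_pos2)
  have "a 0 \<le> C * (C * a 0)"
    using le_next[of 0] next_le[of 0] C0 by (meson less_imp_le mult_left_mono order_trans)
  then have "1 \<le> C * C" using pos[of 0] by (simp flip: mult.assoc)
  then show ?thesis using C0
    by (metis less_imp_le linorder_not_le mult_le_one mult_strict_mono mult_1 zero_le_one order.strict_trans2)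
qed

lemma le_power: "a j \<le> C ^ n * a (j + int n)"
proof (induction n)
  case (Suc n)
  have "C ^ n * a (j + int n) \<le> C ^ n * (C * a (j + int n + 1))"
    using le_next C_ge_1 by (intro mult_left_mono) auto
  then show ?case using Suc by (simp add: algebra_simps)
qed simp

lemma power_le: "a (j + int n) \<le> C ^ n * a j"
proof (induction n)
  case (Suc n)
  have "a (j + int n + 1) \<le> C * (C ^ n * a j)"
    using next_le[of "j + int n"] Suc C_ge_1 by (meson mult_left_mono order_trans zero_le_one)
  then show ?case by (simp add: algebra_simps)
qed simp

lemma reflect: "bounded_ratios (\<lambda>j. a (- j)) C"
proof
  show "0 < a (- j)" for j by (rule pos)
  show "a (- j) \<le> C * a (- (j + 1))" for j using next_le[of "- j - 1"] by simp
  show "a (- (j + 1)) \<le> C * a (- j)" for j using le_next[of "- j - 1"] by simp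
qed

lemma root_sup_ge:
  assumes win: "\<And>n. \<exists>j. j \<in> U \<and> j + int n \<in> U"
    and D: "1 \<le> D"
    and nn: "\<And>n. 1 \<le> n \<Longrightarrow> 0 \<le> r n"
    and upper: "\<And>n j. 1 \<le> n \<Longrightarrow> j \<in> U \<Longrightarrow> j + int n \<in> U \<Longrightarrow> a j \<le> D * r n ^ n * a (j + int n)"
    and n: "1 \<le> n"
  shows "1 / (C * D) \<le> r n"
proof -
  obtain j where j: "j \<in> U" "j + int n \<in> U" using win by blast
  have "a (j + int n) \<le> C ^ n * a j" by (rule power_le)
  also have "\<dots> \<le> C ^ n * (D * r n ^ n * a (j + int n))"
    using upper[OF n j] C_ge_1 by (intro mult_left_mono) auto
  finally have "1 \<le> C ^ n * D * r n ^ n" using pos[of "j + int n"] by (simp flip: mult.assoc)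
  also have "\<dots> \<le> C ^ n * D ^ n * r n ^ n"
  proof -
    have "D ^ 1 \<le> D ^ n" using D n by (intro power_increasing) auto
    then show ?thesis using C_ge_1 nn[OF n] by (intro mult_right_mono mult_left_mono) auto
  qed
  finally have "1 \<le> (C * D * r n) ^ n" by (simp add: power_mult_distrib)
  then have "1 \<le> C * D * r n"
    using n C_ge_1 D nn[OF n] by (metis linorder_not_le mult_nonneg_nonneg order_trans power_less_one_iff zero_le_one not_one_le_zero)
  then show ?thesis using C_ge_1 D by (simp add: field_simps)
qed

text \<open>
  Here \<open>r n ^ n\<close> is, up to the constant \<open>D\<close>, the supremum of \<open>a j / a (j + n)\<close> over the windows in \<open>U\<close>:
  it is an upper bound by \<open>upper\<close>, and the least one by \<open>least\<close>. Cutting a window into two shows that it is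
  quasi-submultiplicative, so the limit always exists, and it is less than 1 if and only if the
  ratios decay geometrically.
\<close>

lemma root_sup_limit_iff:
  assumes interval: "\<And>i j k. i \<in> U \<Longrightarrow> k \<in> U \<Longrightarrow> i \<le> j \<Longrightarrow> j \<le> k \<Longrightarrow> j \<in> U"
    and win: "\<And>n. \<exists>j. j \<in> U \<and> j + int n \<in> U"
    and D: "1 \<le> D"
    and nn: "\<And>n. 1 \<le> n \<Longrightarrow> 0 \<le> r n"
    and upper: "\<And>n j. 1 \<le> n \<Longrightarrow> j \<in> U \<Longrightarrow> j + int n \<in> U \<Longrightarrow> a j \<le> D * r n ^ n * a (j + int n)"
    and least: "\<And>n B. 1 \<le> n \<Longrightarrow> (\<And>j. j \<in> U \<Longrightarrow> j + int n \<in> U \<Longrightarrow> a j \<le> B * a (j + int n)) \<Longrightarrow>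
      r n ^ n \<le> D * B"
  shows "(\<exists>L<1. r \<longlonglongrightarrow> L) \<longleftrightarrow> exp_increasing_on U a"
proof
  assume "\<exists>L<1. r \<longlonglongrightarrow> L"
  then obtain L where L: "L < 1" "r \<longlonglongrightarrow> L" by blast
  obtain q where q: "max L (1 / 2) < q" "q < 1" using dense[of "max L (1 / 2)" 1] L by auto
  have "\<forall>\<^sub>F n in sequentially. r n < q" using order_tendstoD(2)[OF L(2)] q by simp
  then obtain N where N: "\<And>n. N \<le> n \<Longrightarrow> r n < q" by (auto simp: eventually_sequentially)
  \<comment> \<open>The limit controls only windows of length above \<open>N\<close>; for the shorter ones the ratios are at most \<open>C ^ N\<close>.\<close>
  define C' where "C' = D + (C / q) ^ Suc N"
  have "a j \<le> C' * q ^ n * a (j + int n)" if j: "j \<in> U" "j + int n \<in> U" for j n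
  proof (cases "Suc N \<le> n")
    case True
    then have n: "1 \<le> n" "N \<le> n" by auto
    have "r n ^ n \<le> q ^ n" using N[OF n(2)] nn[OF n(1)] by (intro power_mono) auto
    then have "D * r n ^ n * a (j + int n) \<le> D * q ^ n * a (j + int n)"
      using D pos[of "j + int n"] by (intro mult_right_mono mult_left_mono) auto
    also have "\<dots> \<le> C' * q ^ n * a (j + int n)"
      using q C_ge_1 pos[of "j + int n"] by (intro mult_right_mono) (auto simp: C'_def)
    finally show ?thesis using upper[OF n(1) j] by simp
  next
    case False
    have "(C / q) ^ n \<le> (C / q) ^ Suc N"
      using False q C_ge_1 by (intro power_increasing) auto
    then have "(C / q) ^ n \<le> C'" using D by (simp add: C'_def)
    then have "C ^ n \<le> C' * q ^ n" using q by (simp add: power_divide field_simps)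
    then have "C ^ n * a (j + int n) \<le> C' * q ^ n * a (j + int n)"
      using pos[of "j + int n"] by (intro mult_right_mono) auto
    then show ?thesis using le_power[of j n] by simp
  qed
  then show "exp_increasing_on U a"
    unfolding exp_increasing_on_def using q
    by (metis less_divide_eq_numeral1(1) max_less_iff_conj mult_zero_left order.strict_trans zero_less_divide_1_iff zero_less_numeral)
next
  assume "exp_increasing_on U a"
  then obtain C' q where q: "0 < q" "q < 1"
    and h: "\<And>j n. j \<in> U \<Longrightarrow> j + int n \<in> U \<Longrightarrow> a j \<le> C' * q ^ n * a (j + int n)"
    unfolding exp_increasing_on_def by blast
  have "\<exists>L. r \<longlonglongrightarrow> L"
  proof (rule root_converges_if_quasi_submultiplicative)
    show "0 < 1 / (C * D)" using C_ge_1 D by simp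
    show "1 / (C * D) \<le> r n" if "1 \<le> n" for n
      by (rule root_sup_ge[OF win D nn upper that])
    show "0 < D * (D * D)" using D by simp
    fix m n :: nat assume mn: "1 \<le> m" "1 \<le> n"
    have "r (m + n) ^ (m + n) \<le> D * ((D * r m ^ m) * (D * r n ^ n))"
    proof (rule least)
      fix j assume j: "j \<in> U" "j + int (m + n) \<in> U"
      have jm: "j + int m \<in> U" by (rule interval[OF j]) auto
      have "a j \<le> D * r m ^ m * a (j + int m)" using upper mn j jm by blast
      also have "\<dots> \<le> D * r m ^ m * (D * r n ^ n * a (j + int m + int n))"
        using upper[OF mn(2) jm] j D nn[OF mn(1)] by (intro mult_left_mono) (auto simp: add.assoc)
      finally show "a j \<le> (D * r m ^ m) * (D * r n ^ n) * a (j + int (m + n))"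
        by (simp add: algebra_simps)
    qed (use mn in auto)
    then show "r (m + n) ^ (m + n) \<le> D * (D * D) * r m ^ m * r n ^ n"
      by (simp add: mult_ac)
  qed
  then obtain L where L: "r \<longlonglongrightarrow> L" ..
  obtain j where j: "j \<in> U" using win by blast
  have "1 \<le> C'" using h[of j 0] j pos[of j] by simp
  then have DC: "0 < D * C'" using D by simp
  have "r n \<le> root n (D * C') * q" if n: "1 \<le> n" for n
  proof -
    have "r n ^ n \<le> D * (C' * q ^ n)" using n h by (intro least) auto
    then have "root n (r n ^ n) \<le> root n (D * C' * q ^ n)"
      using n by (simp add: mult.assoc)
    then show ?thesis using n nn[OF n] q by (simp add: real_root_mult real_root_power_cancel)
  qed
  moreover have "(\<lambda>n. root n (D * C') * q) \<longlonglongrightarrow> 1 * q"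
    by (intro tendsto_intros LIMSEQ_root_const DC)
  ultimately have "L \<le> 1 * q" using LIMSEQ_le[OF L] by blast
  then show "\<exists>L<1. r \<longlonglongrightarrow> L" using L q by (intro exI[of _ L]) auto
qed

text \<open>
  Reflecting the sequence turns each ratio over a window into its reciprocal, hence infima into suprema. The
  lower bound \<open>root_sup_ge\<close> keeps the limit of the reciprocals away from 0, so that it can be inverted.
\<close>

lemma root_inf_limit_iff:
  assumes interval: "\<And>i j k. i \<in> U \<Longrightarrow> k \<in> U \<Longrightarrow> i \<le> j \<Longrightarrow> j \<le> k \<Longrightarrow> j \<in> U"
    and win: "\<And>n. \<exists>j. j \<in> U \<and> j + int n \<in> U"
    and D: "1 \<le> D"
    and nn: "\<And>n. 1 \<le> n \<Longrightarrow> 0 \<le> r n"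
    and lower: "\<And>n j. 1 \<le> n \<Longrightarrow> j \<in> U \<Longrightarrow> j + int n \<in> U \<Longrightarrow> r n ^ n * a (j + int n) \<le> D * a j"
    and greatest: "\<And>n B. 1 \<le> n \<Longrightarrow> (\<And>j. j \<in> U \<Longrightarrow> j + int n \<in> U \<Longrightarrow> B * a (j + int n) \<le> a j) \<Longrightarrow>
      B \<le> D * r n ^ n"
  shows "(\<exists>L>1. r \<longlonglongrightarrow> L) \<longleftrightarrow> exp_decreasing_on U a"
proof -
  interpret reflected: bounded_ratios "\<lambda>j. a (- j)" C by (rule reflect)
  define s where "s n = 1 / r n" for n
  define V where "V = {j. - j \<in> U}"
  have r_pos: "0 < r n" if n: "1 \<le> n" for n
  proof -
    have "1 / C ^ n \<le> D * r n ^ n"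
    proof (rule greatest[OF n])
      show "1 / C ^ n * a (j + int n) \<le> a j" for j
        using power_le[of j n] C_ge_1 by (simp add: pos_divide_le_eq mult.commute)
    qed
    moreover have "0 < 1 / C ^ n" using C_ge_1 by simp
    ultimately have "r n ^ n \<noteq> 0" by (metis mult_zero_right not_le)
    then show ?thesis using nn[OF n] n by (metis less_eq_real_def power_0_left not_one_le_zero)
  qed
  have winV: "\<exists>j. j \<in> V \<and> j + int n \<in> V" for n
  proof -
    obtain j where "j \<in> U" "j + int n \<in> U" using win by blast
    then show ?thesis by (intro exI[of _ "- j - int n"]) (auto simp: V_def add.commute)
  qed
  have nnV: "0 \<le> s n" if "1 \<le> n" for n using r_pos[OF that] by (simp add: s_def)
  have upperV: "a (- j) \<le> D * s n ^ n * a (- (j + int n))"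
    if "1 \<le> n" "j \<in> V" "j + int n \<in> V" for n j
    using lower[of n "- (j + int n)"] that r_pos[OF that(1)]
    by (simp add: V_def s_def power_one_over field_simps)
  have leastV: "s n ^ n \<le> D * B"
    if n: "1 \<le> n" and B: "\<And>j. j \<in> V \<Longrightarrow> j + int n \<in> V \<Longrightarrow> a (- j) \<le> B * a (- (j + int n))" for n B
  proof -
    have BU: "a (j + int n) \<le> B * a j" if "j \<in> U" "j + int n \<in> U" for j
      using B[of "- (j + int n)"] that by (simp add: V_def add.commute)
    obtain j where j: "j \<in> U" "j + int n \<in> U" using win by blast
    have "0 < B * a j" using BU[OF j] pos[of "j + int n"] by linarith
    then have B0: "0 < B" using pos[of j] by (simp add: zero_less_mult_iff)
    have "1 / B \<le> D * r n ^ n"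
      using BU B0 by (intro greatest[OF n]) (simp add: field_simps)
    then show ?thesis using B0 r_pos[OF n] by (simp add: s_def power_one_over field_simps)
  qed
  have "(\<exists>L<1. s \<longlonglongrightarrow> L) \<longleftrightarrow> exp_increasing_on V (\<lambda>j. a (- j))"
  proof (rule reflected.root_sup_limit_iff[OF _ winV D nnV upperV leastV])
    show "j \<in> V" if "i \<in> V" "k \<in> V" "i \<le> j" "j \<le> k" for i j k
      using interval[of "- k" "- i" "- j"] that by (simp add: V_def)
  qed
  moreover have "(\<exists>L<1. s \<longlonglongrightarrow> L) \<longleftrightarrow> (\<exists>L>1. r \<longlonglongrightarrow> L)"
  proof
    assume "\<exists>L<1. s \<longlonglongrightarrow> L"
    then obtain L where L: "L < 1" "s \<longlonglongrightarrow> L" by blast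
    have "1 / (C * D) \<le> L"
      using reflected.root_sup_ge[OF winV D nnV upperV]
      by (intro tendsto_lowerbound[OF L(2)]) (auto simp: eventually_sequentially)
    then have L0: "0 < L" using C_ge_1 D
      by (smt (verit) divide_pos_pos mult_pos_pos)
    have "(\<lambda>n. 1 / s n) \<longlonglongrightarrow> 1 / L" using L L0 by (intro tendsto_intros) auto
    then have "r \<longlonglongrightarrow> 1 / L" by (simp add: s_def)
    then show "\<exists>L>1. r \<longlonglongrightarrow> L" using L L0 by (intro exI[of _ "1 / L"]) auto
  next
    assume "\<exists>L>1. r \<longlonglongrightarrow> L"
    then obtain L where L: "1 < L" "r \<longlonglongrightarrow> L" by blast
    then have "s \<longlonglongrightarrow> 1 / L" unfolding s_def by (intro tendsto_intros) auto
    then show "\<exists>L<1. s \<longlonglongrightarrow> L" using L by (intro exI[of _ "1 / L"]) auto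
  qed
  ultimately show ?thesis unfolding exp_decreasing_reflect V_def by simp
qed

end

section \<open>The window quantities of the three conditions\<close>

lemma powr_inverse_nat_power:
  assumes "1 \<le> n" "0 \<le> (x::real)"
  shows "(x powr (1 / real n)) ^ n = x"
  using assms by (cases "x = 0") (auto simp: powr_power)

context bounded_ratios
begin

definition ratio :: "int \<Rightarrow> nat \<Rightarrow> real"
  where "ratio j n = a j / a (j + int n)"

lemma ratio_pos: "0 < ratio j n"
  by (simp add: ratio_def pos)

lemma ratio_le: "ratio j n \<le> C ^ n"
  using le_power[of j n] pos[of "j + int n"] by (simp add: ratio_def field_simps)

lemma ratio_Suc_le: "ratio j (Suc n) \<le> C * ratio j n"
proof -
  have aux: "u / w \<le> C * (u / v)" if "v \<le> C * w" "0 < u" "0 < v" "0 < w" for u v w :: real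
  proof -
    have "u * v \<le> u * (C * w)" using that by (intro mult_left_mono) auto
    then show ?thesis using that by (simp add: field_simps)
  qed
  have idx: "j + int (Suc n) = j + int n + 1" by simp
  show ?thesis unfolding ratio_def idx by (intro aux le_next pos)
qed

lemma le_ratio_Suc: "ratio j n \<le> C * ratio j (Suc n)"
proof -
  have aux: "u / v \<le> C * (u / w)" if "w \<le> C * v" "0 < u" "0 < v" "0 < w" for u v w :: real
  proof -
    have "u * w \<le> u * (C * v)" using that by (intro mult_left_mono) auto
    then show ?thesis using that by (simp add: field_simps)
  qed
  have idx: "j + int (Suc n) = j + int n + 1" by simp
  show ?thesis unfolding ratio_def idx by (intro aux next_le pos)
qed

lemma bdd_above_ratio: "bdd_above ((\<lambda>k. ratio (f k) n) ` I)"
  by (rule bdd_aboveI2[of _ _ "C ^ n"]) (rule ratio_le)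

lemma bdd_below_ratio: "bdd_below ((\<lambda>k. ratio (f k) n) ` I)"
  by (rule bdd_belowI2[of _ 0]) (rule less_imp_le[OF ratio_pos])

text \<open>
  The first and third families consist of windows of length \<open>n + 1\<close>, the second of windows of length
  \<open>n\<close>. Every window of length \<open>n\<close> lies in the second family if it ends before 0; otherwise, extended by one step
  to the right, it lies in the first or the third family. Since extending a window costs at most the factor \<open>C\<close>,
  the maximum is the supremum over all windows up to that factor.
\<close>

lemma window_sup_limit_iff:
  "(\<exists>L<1. (\<lambda>n::nat.
      (Max {SUP k\<in>{1::int..}. a (k - 1) / a (k + int n),
            SUP k\<in>{int n..}. a (- k - 1) / a (- k + int n - 1),
            SUP k\<in>{0..<int n}. a (- k - 1) / a (- k + int n)})
      powr (1 / real n)) \<longlonglongrightarrow> L) \<longleftrightarrow> exp_increasing_on UNIV a"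
proof -
  have idx: "ratio (k - 1) (Suc n) = a (k - 1) / a (k + int n)"
    "ratio (- k - 1) n = a (- k - 1) / a (- k + int n - 1)"
    "ratio (- k - 1) (Suc n) = a (- k - 1) / a (- k + int n)" for k n
    by (simp_all add: ratio_def add.commute add_diff_eq)
  define Q where "Q n = Max {SUP k\<in>{1::int..}. ratio (k - 1) (Suc n),
      SUP k\<in>{int n..}. ratio (- k - 1) n, SUP k\<in>{0..<int n}. ratio (- k - 1) (Suc n)}" for n
  have Q_ge: "ratio j n \<le> C * Q n" if n: "1 \<le> n" for j n
  proof -
    consider "0 \<le> j" | "j + int n \<le> -1" | "j < 0" "0 \<le> j + int n" by linarith
    then show ?thesis
    proof cases
      case 1
      have "ratio ((j + 1) - 1) (Suc n) \<le> (SUP k\<in>{1::int..}. ratio (k - 1) (Suc n))"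
        using 1 by (intro cSUP_upper bdd_above_ratio) auto
      also have "\<dots> \<le> Q n" by (simp add: Q_def)
      finally have "C * ratio j (Suc n) \<le> C * Q n" using C_ge_1 by (intro mult_left_mono) auto
      then show ?thesis using le_ratio_Suc[of j n] by simp
    next
      case 2
      have "ratio (- (- j - 1) - 1) n \<le> (SUP k\<in>{int n..}. ratio (- k - 1) n)"
        using 2 by (intro cSUP_upper bdd_above_ratio) auto
      also have "\<dots> \<le> Q n" by (simp add: Q_def)
      finally have "ratio j n \<le> Q n" by simp
      moreover from this have "1 * Q n \<le> C * Q n"
        using C_ge_1 ratio_pos[of j n] by (intro mult_right_mono) auto
      ultimately show ?thesis by simp
    next
      case 3
      have "ratio (- (- j - 1) - 1) (Suc n) \<le> (SUP k\<in>{0..<int n}. ratio (- k - 1) (Suc n))"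
        using 3 by (intro cSUP_upper bdd_above_ratio) auto
      also have "\<dots> \<le> Q n" by (simp add: Q_def)
      finally have "C * ratio j (Suc n) \<le> C * Q n" using C_ge_1 by (intro mult_left_mono) auto
      then show ?thesis using le_ratio_Suc[of j n] by simp
    qed
  qed
  have Q_pos: "0 < Q n" if "1 \<le> n" for n
    using Q_ge[OF that, of 0] ratio_pos[of 0 n] C_ge_1
    by (smt (verit) zero_less_mult_pos)
  have Q_le: "Q n \<le> C * B" if n: "1 \<le> n" and B: "\<And>j. ratio j n \<le> B" for n B
  proof -
    have B0: "0 \<le> B" using B[of 0] ratio_pos[of 0 n] by simp
    have "ratio j (Suc n) \<le> C * B" for j
    proof -
      have "C * ratio j n \<le> C * B" using B C_ge_1 by (intro mult_left_mono) auto
      then show ?thesis using ratio_Suc_le[of j n] by simp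
    qed
    moreover have "ratio j n \<le> C * B" for j
    proof -
      have "1 * B \<le> C * B" using B0 C_ge_1 by (intro mult_right_mono) auto
      then show ?thesis using B[of j] by simp
    qed
    ultimately show ?thesis using n by (auto simp: Q_def intro!: cSUP_least)
  qed
  have "(\<exists>L<1. (\<lambda>n. Q n powr (1 / real n)) \<longlonglongrightarrow> L) \<longleftrightarrow> exp_increasing_on UNIV a"
  proof (rule root_sup_limit_iff)
    fix n j assume n: "1 \<le> (n::nat)"
    show "a j \<le> C * (Q n powr (1 / real n)) ^ n * a (j + int n)"
      using Q_ge[OF n, of j] pos[of "j + int n"] Q_pos[OF n] n
      by (simp add: powr_inverse_nat_power ratio_def field_simps)
  next
    fix n B assume n: "1 \<le> (n::nat)"
      and B: "\<And>j. j \<in> UNIV \<Longrightarrow> j + int n \<in> UNIV \<Longrightarrow> a j \<le> B * a (j + int n)"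
    have "ratio j n \<le> B" for j using B[of j] pos[of "j + int n"] by (simp add: ratio_def field_simps)
    then show "(Q n powr (1 / real n)) ^ n \<le> C * B"
      using Q_le[OF n] Q_pos[OF n] n by (simp add: powr_inverse_nat_power)
  qed (auto simp: C_ge_1)
  then show ?thesis unfolding Q_def by (simp only: idx)
qed

lemma window_inf_limit_iff:
  "(\<exists>L>1. (\<lambda>n::nat.
      (Min {INF k\<in>{1::int..}. a (k - 1) / a (k + int n),
            INF k\<in>{int n..}. a (- k - 1) / a (- k + int n - 1),
            INF k\<in>{0..<int n}. a (- k - 1) / a (- k + int n)})
      powr (1 / real n)) \<longlonglongrightarrow> L) \<longleftrightarrow> exp_decreasing_on UNIV a"
proof -
  have idx: "ratio (k - 1) (Suc n) = a (k - 1) / a (k + int n)"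
    "ratio (- k - 1) n = a (- k - 1) / a (- k + int n - 1)"
    "ratio (- k - 1) (Suc n) = a (- k - 1) / a (- k + int n)" for k n
    by (simp_all add: ratio_def add.commute add_diff_eq)
  define Q where "Q n = Min {INF k\<in>{1::int..}. ratio (k - 1) (Suc n),
      INF k\<in>{int n..}. ratio (- k - 1) n, INF k\<in>{0..<int n}. ratio (- k - 1) (Suc n)}" for n
  have Q_le: "Q n \<le> C * ratio j n" if n: "1 \<le> n" for j n
  proof -
    consider "0 \<le> j" | "j + int n \<le> -1" | "j < 0" "0 \<le> j + int n" by linarith
    then show ?thesis
    proof cases
      case 1
      have "(INF k\<in>{1::int..}. ratio (k - 1) (Suc n)) \<le> ratio ((j + 1) - 1) (Suc n)"
        using 1 by (intro cINF_lower bdd_below_ratio) auto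
      moreover have "Q n \<le> (INF k\<in>{1::int..}. ratio (k - 1) (Suc n))" by (simp add: Q_def)
      ultimately show ?thesis using ratio_Suc_le[of j n] by simp
    next
      case 2
      have "(INF k\<in>{int n..}. ratio (- k - 1) n) \<le> ratio (- (- j - 1) - 1) n"
        using 2 by (intro cINF_lower bdd_below_ratio) auto
      moreover have "Q n \<le> (INF k\<in>{int n..}. ratio (- k - 1) n)" by (simp add: Q_def)
      moreover have "ratio j n \<le> C * ratio j n"
        using C_ge_1 ratio_pos[of j n] mult_right_mono[of 1 C "ratio j n"] by simp
      ultimately show ?thesis by simp
    next
      case 3
      have "(INF k\<in>{0..<int n}. ratio (- k - 1) (Suc n)) \<le> ratio (- (- j - 1) - 1) (Suc n)"
        using 3 by (intro cINF_lower bdd_below_ratio) auto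
      moreover have "Q n \<le> (INF k\<in>{0..<int n}. ratio (- k - 1) (Suc n))" by (simp add: Q_def)
      ultimately show ?thesis using ratio_Suc_le[of j n] by simp
    qed
  qed
  have Q_ge: "B / C \<le> Q n" if n: "1 \<le> n" and B: "\<And>j. B \<le> ratio j n" and B0: "0 \<le> B" for n B
  proof -
    have "B / C \<le> ratio j (Suc n)" for j
      using le_ratio_Suc[of j n] B[of j] C_ge_1 by (simp add: field_simps)
    moreover have "B / C \<le> ratio j n" for j
    proof -
      have "B / C \<le> B / 1" using B0 C_ge_1 by (intro divide_left_mono) auto
      then show ?thesis using B[of j] by simp
    qed
    ultimately show ?thesis using n by (auto simp: Q_def intro!: cINF_greatest)
  qed
  have Q_nonneg: "0 \<le> Q n" if "1 \<le> n" for n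
    using Q_ge[OF that, of 0] ratio_pos by (simp add: less_imp_le)
  have "(\<exists>L>1. (\<lambda>n. Q n powr (1 / real n)) \<longlonglongrightarrow> L) \<longleftrightarrow> exp_decreasing_on UNIV a"
  proof (rule root_inf_limit_iff)
    fix n j assume n: "1 \<le> (n::nat)"
    show "(Q n powr (1 / real n)) ^ n * a (j + int n) \<le> C * a j"
      using Q_le[OF n, of j] pos[of "j + int n"] Q_nonneg[OF n] n
      by (simp add: powr_inverse_nat_power ratio_def field_simps)
  next
    fix n B assume n: "1 \<le> (n::nat)"
      and B: "\<And>j. j \<in> UNIV \<Longrightarrow> j + int n \<in> UNIV \<Longrightarrow> B * a (j + int n) \<le> a j"
    have le: "B \<le> ratio j n" for j using B[of j] pos[of "j + int n"] by (simp add: ratio_def field_simps)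
    show "B \<le> C * (Q n powr (1 / real n)) ^ n"
    proof (cases "0 \<le> B")
      case True
      then show ?thesis
        using Q_ge[OF n le True] Q_nonneg[OF n] n C_ge_1
        by (simp add: powr_inverse_nat_power field_simps)
    next
      case False
      have "0 \<le> C * (Q n powr (1 / real n)) ^ n" using C_ge_1 by simp
      then show ?thesis using False by linarith
    qed
  qed (auto simp: C_ge_1)
  then show ?thesis unfolding Q_def by (simp only: idx)
qed

text \<open>
  The windows here are those of length \<open>n + 1\<close> in the negative half-line. The root is taken inside the
  supremum, so \<open>r\<close> is the supremum of the roots. To reach a given window of length \<open>n\<close> it is extended to the
  left, which stays in the half-line.
\<close>

lemma negative_sup_limit_iff:
  "(\<exists>L<1. (\<lambda>n::nat. SUP k\<in>{1::int..}. (a (- k - int n - 1) / a (- k)) powr (1 / real n))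
      \<longlonglongrightarrow> L) \<longleftrightarrow> exp_increasing_on {..-1} a"
proof -
  have idx: "ratio (- k - int n - 1) (Suc n) = a (- k - int n - 1) / a (- k)" for k n
    by (simp add: ratio_def)
  define r where "r n = (SUP k\<in>{1::int..}. ratio (- k - int n - 1) (Suc n) powr (1 / real n))" for n
  have bdd: "bdd_above ((\<lambda>k. ratio (- k - int n - 1) (Suc n) powr (1 / real n)) ` I)" for n I
    by (rule bdd_aboveI2[of _ _ "(C ^ Suc n) powr (1 / real n)"])
      (intro powr_mono2 ratio_le less_imp_le[OF ratio_pos], auto)
  have r_ge: "ratio (- k - int n - 1) (Suc n) powr (1 / real n) \<le> r n" if "1 \<le> k" for k n
    unfolding r_def using that by (intro cSUP_upper bdd) auto
  have r_nonneg: "0 \<le> r n" for n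
    using r_ge[of 1 n] powr_ge_zero order_trans by (metis order_refl)
  have "(\<exists>L<1. r \<longlonglongrightarrow> L) \<longleftrightarrow> exp_increasing_on {..-1} a"
  proof (rule root_sup_limit_iff)
    fix n :: nat
    show "\<exists>j. j \<in> {..-1} \<and> j + int n \<in> {..-1}" by (rule exI[of _ "- int n - 1"]) auto
  next
    fix n j assume n: "1 \<le> (n::nat)" and j: "j \<in> {..-1}" "j + int n \<in> {..-1}"
    define i where "i = j - 1"
    have "ratio i (Suc n) = (ratio i (Suc n) powr (1 / real n)) ^ n"
      using n ratio_pos[of i "Suc n"] by (simp add: powr_inverse_nat_power)
    also have "\<dots> \<le> r n ^ n"
      using r_ge[of "- j - int n" n] j by (intro power_mono) (auto simp: i_def)
    finally have "a i \<le> r n ^ n * a (j + int n)"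
      using pos[of "j + int n"] by (simp add: ratio_def i_def field_simps)
    then have "C * a i \<le> C * (r n ^ n * a (j + int n))"
      using C_ge_1 by (intro mult_left_mono) auto
    then show "a j \<le> C * r n ^ n * a (j + int n)"
      using next_le[of i] by (simp add: i_def)
  next
    fix n B assume n: "1 \<le> (n::nat)"
      and B: "\<And>j. j \<in> {..-1} \<Longrightarrow> j + int n \<in> {..-1} \<Longrightarrow> a j \<le> B * a (j + int n)"
    have "0 < B * a (-1)" using B[of "-1 - int n"] pos[of "-1 - int n"] by auto
    then have B0: "0 < B" using pos[of "-1"] by (simp add: zero_less_mult_iff)
    have "r n \<le> (C * B) powr (1 / real n)"
      unfolding r_def
    proof (rule cSUP_least)
      fix k :: int assume k: "k \<in> {1..}"
      have "ratio (- k - int n - 1) (Suc n) \<le> C * ratio (- k - int n) n"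
      proof -
        have "a (- k - int n - 1) / a (- k) \<le> C * a (- k - int n) / a (- k)"
          using le_next[of "- k - int n - 1"] less_imp_le[OF pos] by (intro divide_right_mono) auto
        then show ?thesis by (simp add: ratio_def)
      qed
      also have "\<dots> \<le> C * B"
        using B[of "- k - int n"] k pos[of "- k"] C_ge_1
        by (intro mult_left_mono) (auto simp: ratio_def field_simps)
      finally show "ratio (- k - int n - 1) (Suc n) powr (1 / real n) \<le> (C * B) powr (1 / real n)"
        using ratio_pos less_imp_le by (intro powr_mono2) auto
    qed simp
    then have "r n ^ n \<le> ((C * B) powr (1 / real n)) ^ n"
      using r_nonneg by (intro power_mono)
    then show "r n ^ n \<le> C * B" using n B0 C_ge_1 by (simp add: powr_inverse_nat_power)
  qed (auto simp: C_ge_1 r_nonneg)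
  then show ?thesis unfolding r_def by (simp only: idx)
qed

lemma positive_inf_limit_iff:
  "(\<exists>L>1. (\<lambda>n::nat. INF k\<in>{1::int..}. (a (k - 1) / a (k + int n)) powr (1 / real n))
      \<longlonglongrightarrow> L) \<longleftrightarrow> exp_decreasing_on {0..} a"
proof -
  have idx: "ratio (k - 1) (Suc n) = a (k - 1) / a (k + int n)" for k n
    by (simp add: ratio_def)
  define r where "r n = (INF k\<in>{1::int..}. ratio (k - 1) (Suc n) powr (1 / real n))" for n
  have bdd: "bdd_below ((\<lambda>k. ratio (k - 1) (Suc n) powr (1 / real n)) ` I)" for n I
    by (rule bdd_belowI2[of _ 0]) simp
  have r_le: "r n \<le> ratio j (Suc n) powr (1 / real n)" if "0 \<le> j" for j n
    unfolding r_def using that cINF_lower[OF bdd[of n "{1..}"], of "j + 1"] by simp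
  have r_ge: "(B / C) powr (1 / real n) \<le> r n"
    if B: "\<And>j. 0 \<le> j \<Longrightarrow> B \<le> ratio j n" and B0: "0 \<le> B" for n B
    unfolding r_def
  proof (rule cINF_greatest)
    fix k :: int assume k: "k \<in> {1..}"
    have "B \<le> C * ratio (k - 1) (Suc n)" using B[of "k - 1"] le_ratio_Suc[of "k - 1" n] k by simp
    then have "B / C \<le> ratio (k - 1) (Suc n)" using C_ge_1 by (simp add: field_simps)
    then show "(B / C) powr (1 / real n) \<le> ratio (k - 1) (Suc n) powr (1 / real n)"
      using B0 C_ge_1 by (intro powr_mono2) auto
  qed simp
  have r_nonneg: "0 \<le> r n" for n
    using r_ge[of 0 n] ratio_pos by (simp add: less_imp_le)
  have "(\<exists>L>1. r \<longlonglongrightarrow> L) \<longleftrightarrow> exp_decreasing_on {0..} a"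
  proof (rule root_inf_limit_iff)
    fix n :: nat
    show "\<exists>j. j \<in> {0..} \<and> j + int n \<in> {0..}" by (rule exI[of _ 0]) auto
  next
    fix n j assume n: "1 \<le> (n::nat)" and j: "j \<in> {0::int..}" "j + int n \<in> {0..}"
    have "r n ^ n \<le> (ratio j (Suc n) powr (1 / real n)) ^ n"
      using r_le[of j n] r_nonneg j by (intro power_mono) auto
    also have "\<dots> = ratio j (Suc n)"
      using n ratio_pos[of j "Suc n"] by (simp add: powr_inverse_nat_power)
    also have "\<dots> \<le> C * ratio j n" by (rule ratio_Suc_le)
    finally show "r n ^ n * a (j + int n) \<le> C * a j"
      using pos[of "j + int n"] by (simp add: ratio_def field_simps)
  next
    fix n B assume n: "1 \<le> (n::nat)"
      and B: "\<And>j. j \<in> {0..} \<Longrightarrow> j + int n \<in> {0..} \<Longrightarrow> B * a (j + int n) \<le> a j"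
    have le: "B \<le> ratio j n" if "0 \<le> j" for j
      using B[of j] that pos[of "j + int n"] by (simp add: ratio_def field_simps)
    show "B \<le> C * r n ^ n"
    proof (cases "0 \<le> B")
      case True
      have "((B / C) powr (1 / real n)) ^ n \<le> r n ^ n"
        using r_ge[OF le True] by (intro power_mono) auto
      then show ?thesis
        using n True C_ge_1 by (simp add: powr_inverse_nat_power field_simps)
    next
      case False
      have "0 \<le> C * r n ^ n" using C_ge_1 r_nonneg by simp
      then show ?thesis using False by linarith
    qed
  qed (auto simp: C_ge_1 r_nonneg)
  then show ?thesis unfolding r_def by (simp only: idx)
qed

end

section \<open>Convolution with a geometric kernel\<close>

lemma geometric_summable_on_int:
  fixes q :: real
  assumes "0 < q" "q < 1"
  shows "(\<lambda>i::int. q ^ nat \<bar>i\<bar>) summable_on UNIV"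
proof -
  have nat: "(\<lambda>n. q ^ n) summable_on (UNIV :: nat set)"
    using assms by (intro norm_summable_imp_summable_on) (simp add: norm_power summable_geometric)
  have "(\<lambda>i. q ^ nat \<bar>i\<bar>) summable_on range int"
    by (subst summable_on_reindex) (auto simp: o_def nat)
  moreover have "(\<lambda>i. q ^ nat \<bar>i\<bar>) summable_on range (\<lambda>n. - int n)"
    by (subst summable_on_reindex) (auto simp: o_def nat inj_on_def)
  ultimately have "(\<lambda>i. q ^ nat \<bar>i\<bar>) summable_on (range int \<union> range (\<lambda>n. - int n))"
    by (rule summable_on_union)
  moreover have "range int \<union> range (\<lambda>n. - int n) = UNIV"
  proof -
    have "i \<in> range int \<union> range (\<lambda>n. - int n)" for i
      by (cases i rule: int_cases2) auto
    then show ?thesis by blast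
  qed
  ultimately show ?thesis by simp
qed

lemma geometric_weighted_summable_on:
  fixes s :: "int \<Rightarrow> real"
  assumes "0 < q" "q < 1" and s: "\<And>i. 0 \<le> s i" "\<And>i. s i \<le> Z"
  shows "(\<lambda>i. q ^ nat \<bar>i\<bar> * s i) summable_on UNIV"
proof (rule summable_on_comparison_test)
  show "(\<lambda>i::int. q ^ nat \<bar>i\<bar> * Z) summable_on UNIV"
    by (intro summable_on_cmult_left geometric_summable_on_int assms)
qed (use assms in \<open>auto intro!: mult_left_mono\<close>)

text \<open>
  With \<open>q = r\<^sup>2\<close>, one factor \<open>r\<close> of the weight is kept for summability and the other one stays with \<open>s\<close>: the sum is at most
  \<open>\<Sum> r\<^sup>i\<close> times the largest \<open>r\<^sup>i s\<^sub>i\<close>, and the \<open>p\<close>-th power of the largest term is at most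
  the sum of the \<open>p\<close>-th powers. This elementary substitute for Hoelder's inequality costs only a constant.
\<close>

lemma infsum_geometric_weighted_powr_le:
  fixes s :: "int \<Rightarrow> real"
  assumes r: "0 < r" "r < 1" and p: "0 < p" and s: "\<And>i. 0 \<le> s i" "\<And>i. s i \<le> Z"
  shows "(\<Sum>\<^sub>\<infinity>i. (r ^ 2) ^ nat \<bar>i\<bar> * s i) powr p
    \<le> (\<Sum>\<^sub>\<infinity>i::int. r ^ nat \<bar>i\<bar>) powr p * (\<Sum>\<^sub>\<infinity>i. (r powr p) ^ nat \<bar>i\<bar> * s i powr p)"
proof -
  define T where "T = (\<Sum>\<^sub>\<infinity>i. (r powr p) ^ nat \<bar>i\<bar> * s i powr p)"
  have rp: "0 < r powr p" "r powr p < 1"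
    using r p powr_less_mono2[of p r 1] by auto
  have T_summable: "(\<lambda>i. (r powr p) ^ nat \<bar>i\<bar> * s i powr p) summable_on UNIV"
    using rp s p by (intro geometric_weighted_summable_on[where Z = "Z powr p"]) (auto intro: powr_mono2)
  have T_nonneg: "0 \<le> T" unfolding T_def by (intro infsum_nonneg) simp
  have term_le: "r ^ nat \<bar>i\<bar> * s i \<le> T powr (1 / p)" for i
  proof -
    have "(\<Sum>i\<in>{i}. (r powr p) ^ nat \<bar>i\<bar> * s i powr p) \<le> T"
      unfolding T_def by (intro finite_sum_le_infsum T_summable) auto
    moreover have "(r powr p) ^ nat \<bar>i\<bar> * s i powr p = (r ^ nat \<bar>i\<bar> * s i) powr p"
    proof -
      have "(r powr p) ^ k = (r ^ k) powr p" for k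
        using r by (induction k) (auto simp: powr_mult)
      then show ?thesis using r s by (simp add: powr_mult)
    qed
    ultimately have "(r ^ nat \<bar>i\<bar> * s i) powr p \<le> T" by simp
    then have "((r ^ nat \<bar>i\<bar> * s i) powr p) powr (1 / p) \<le> T powr (1 / p)"
      using p by (intro powr_mono2) auto
    then show ?thesis using p r s by (simp add: powr_powr)
  qed
  have "(\<Sum>\<^sub>\<infinity>i. (r ^ 2) ^ nat \<bar>i\<bar> * s i) \<le> (\<Sum>\<^sub>\<infinity>i::int. r ^ nat \<bar>i\<bar> * T powr (1 / p))"
  proof (rule infsum_mono)
    show "(\<lambda>i. (r ^ 2) ^ nat \<bar>i\<bar> * s i) summable_on UNIV"
      using r s power_strict_mono[of r 1 2]
      by (intro geometric_weighted_summable_on[where Z = Z]) auto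
    show "(\<lambda>i::int. r ^ nat \<bar>i\<bar> * T powr (1 / p)) summable_on UNIV"
      by (intro summable_on_cmult_left geometric_summable_on_int r)
    fix i :: int
    have "(r ^ 2) ^ nat \<bar>i\<bar> = r ^ nat \<bar>i\<bar> * r ^ nat \<bar>i\<bar>"
      by (simp add: power2_eq_square power_mult_distrib)
    then show "(r ^ 2) ^ nat \<bar>i\<bar> * s i \<le> r ^ nat \<bar>i\<bar> * T powr (1 / p)"
      using term_le[of i] r by (simp add: mult.assoc)
  qed
  also have "\<dots> = (\<Sum>\<^sub>\<infinity>i::int. r ^ nat \<bar>i\<bar>) * T powr (1 / p)"
    by (rule infsum_cmult_left')
  finally have le: "(\<Sum>\<^sub>\<infinity>i. (r ^ 2) ^ nat \<bar>i\<bar> * s i) \<le> (\<Sum>\<^sub>\<infinity>i::int. r ^ nat \<bar>i\<bar>) * T powr (1 / p)" .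
  have "0 \<le> (\<Sum>\<^sub>\<infinity>i. (r ^ 2) ^ nat \<bar>i\<bar> * s i)"
    using s r by (intro infsum_nonneg) auto
  then have "(\<Sum>\<^sub>\<infinity>i. (r ^ 2) ^ nat \<bar>i\<bar> * s i) powr p
    \<le> ((\<Sum>\<^sub>\<infinity>i::int. r ^ nat \<bar>i\<bar>) * T powr (1 / p)) powr p"
    using le p by (intro powr_mono2) auto
  also have "\<dots> = (\<Sum>\<^sub>\<infinity>i::int. r ^ nat \<bar>i\<bar>) powr p * T"
    using p T_nonneg r by (subst powr_mult) (auto simp: powr_powr intro!: infsum_nonneg)
  finally show ?thesis unfolding T_def .
qed

lemma has_sum_finite_sum:
  fixes f :: "'n \<Rightarrow> 'i \<Rightarrow> real"
  assumes "\<And>n. n \<in> F \<Longrightarrow> (f n has_sum g n) X"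
  shows "((\<lambda>i. \<Sum>n\<in>F. f n i) has_sum (\<Sum>n\<in>F. g n)) X"
  using assms by (induction F rule: infinite_finite_induct) (auto intro!: has_sum_add)

lemma norm_le_lp_norm:
  assumes p: "0 < p" and y: "y \<in> lp p"
  shows "norm (y n) \<le> lp_norm p y"
proof -
  have "(\<Sum>i\<in>{n}. norm (y i) powr p) \<le> (\<Sum>\<^sub>\<infinity>i. norm (y i) powr p)"
    using y by (intro finite_sum_le_infsum) (auto simp: lp_def)
  then have "(norm (y n) powr p) powr (1 / p) \<le> lp_norm p y"
    unfolding lp_norm_def using p by (intro powr_mono2) auto
  then show ?thesis using p by (simp add: powr_powr)
qed

lemma lp_shift:
  assumes "y \<in> lp p"
  shows "(\<lambda>n. y (n + i)) \<in> lp p" and "lp_norm p (\<lambda>n. y (n + i)) = lp_norm p y"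
proof -
  have bij: "bij_betw (\<lambda>n. n + i) UNIV UNIV"
    by (rule bij_betw_byWitness[where f' = "\<lambda>n. n - i"]) auto
  show "(\<lambda>n. y (n + i)) \<in> lp p"
    using assms summable_on_reindex_bij_betw[OF bij, of "\<lambda>n. norm (y n) powr p"] by (simp add: lp_def)
  show "lp_norm p (\<lambda>n. y (n + i)) = lp_norm p y"
    using infsum_reindex_bij_betw[OF bij, of "\<lambda>n. norm (y n) powr p"] by (simp add: lp_norm_def)
qed

lemma lp_single:
  assumes "0 < p"
  shows "(\<lambda>m. if m = k then v else 0) \<in> lp p"
    and "lp_norm p (\<lambda>m. if m = k then v else 0) = norm v"
proof -
  have "((\<lambda>m. norm (if m = k then v else 0) powr p) has_sum norm v powr p) {k}"
    by (intro has_sum_finiteI) auto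
  also have "?this \<longleftrightarrow> ((\<lambda>m. norm (if m = k then v else 0) powr p) has_sum norm v powr p) UNIV"
    by (rule has_sum_cong_neutral) auto
  finally have *: "((\<lambda>m. norm (if m = k then v else 0) powr p) has_sum norm v powr p) UNIV" .
  then show "(\<lambda>m. if m = k then v else 0) \<in> lp p"
    unfolding lp_def by (auto dest: has_sum_imp_summable)
  show "lp_norm p (\<lambda>m. if m = k then v else 0) = norm v"
    unfolding lp_norm_def infsumI[OF *] using assms by (simp add: powr_powr)
qed

text \<open>
  The constant \<open>D\<close> depends on \<open>q\<close>, \<open>p\<close>, and \<open>k\<close> only, which is what the shadowing property asks for. It is
  enough to bound finite sums over \<open>n\<close>; these may be interchanged with the sum over \<open>i\<close>, and then
  each \<open>y i\<close> contributes its own \<open>\<ell>\<^sub>p\<close> norm, weighted by \<open>r\<^sup>p\<^sup>i\<close>.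
\<close>

lemma lp_norm_geometric_convolution:
  fixes y :: "int \<Rightarrow> int \<Rightarrow> 'x::real_normed_vector"
  assumes q: "0 < q" "q < 1" and p: "0 < p" and k: "0 \<le> k"
  shows "\<exists>D>0. \<forall>y Z (x :: int \<Rightarrow> 'y::real_normed_vector).
    (\<forall>i. (y i :: int \<Rightarrow> 'x) \<in> lp p \<and> lp_norm p (y i) \<le> Z) \<longrightarrow>
    (\<forall>n. norm (x n) \<le> k * (\<Sum>\<^sub>\<infinity>i. q ^ nat \<bar>i\<bar> * norm (y i n))) \<longrightarrow>
    x \<in> lp p \<and> lp_norm p x \<le> D * Z"
proof -
  define r where "r = sqrt q"
  have r: "0 < r" "r < 1" "r ^ 2 = q" using q by (auto simp: r_def)
  have rp: "0 < r powr p" "r powr p < 1"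
    using r p powr_less_mono2[of p r 1] by auto
  define G1 where "G1 = k powr p * (\<Sum>\<^sub>\<infinity>i::int. r ^ nat \<bar>i\<bar>) powr p"
  define G2 where "G2 = (\<Sum>\<^sub>\<infinity>i::int. (r powr p) ^ nat \<bar>i\<bar>)"
  have G1: "0 \<le> G1" by (simp add: G1_def)
  have G2: "0 \<le> G2" unfolding G2_def by (intro infsum_nonneg) simp
  define D where "D = (G1 * G2) powr (1 / p) + 1"
  have main: "x \<in> lp p \<and> lp_norm p x \<le> D * Z"
    if y: "\<And>i. y i \<in> lp p" "\<And>i. lp_norm p (y i) \<le> Z"
      and x: "\<And>n. norm (x n) \<le> k * (\<Sum>\<^sub>\<infinity>i. q ^ nat \<bar>i\<bar> * norm (y i n))"
    for y :: "int \<Rightarrow> int \<Rightarrow> 'x" and Z and x :: "int \<Rightarrow> 'y"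
  proof -
    have Z0: "0 \<le> Z" using y(2)[of 0] unfolding lp_norm_def by (rule order_trans[rotated]) simp
    have sm: "(\<lambda>n. norm (y i n) powr p) summable_on UNIV" for i
      using y(1) by (simp add: lp_def)
    have infsum_le: "(\<Sum>\<^sub>\<infinity>n. norm (y i n) powr p) \<le> Z powr p" for i
    proof -
      have nn: "0 \<le> (\<Sum>\<^sub>\<infinity>n. norm (y i n) powr p)" by (intro infsum_nonneg) simp
      have "(lp_norm p (y i)) powr p \<le> Z powr p"
        using y(2) p by (intro powr_mono2) (auto simp: lp_norm_def)
      then show ?thesis using p nn by (simp add: lp_norm_def powr_powr)
    qed
    have finite_le: "(\<Sum>n\<in>F. norm (y i n) powr p) \<le> Z powr p" if "finite F" for F i
      using finite_sum_le_infsum[OF sm[of i] that] infsum_le[of i] by simp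
    have y_le: "norm (y i n) \<le> Z" for i n
      using norm_le_lp_norm[OF p y(1)] y(2) order_trans by blast
    have sw: "(\<lambda>i. (r powr p) ^ nat \<bar>i\<bar> * norm (y i n) powr p) summable_on UNIV" for n
      using rp y_le p by (intro geometric_weighted_summable_on[where Z = "Z powr p"]) (auto intro: powr_mono2)
    have x_powr: "norm (x n) powr p
        \<le> G1 * (\<Sum>\<^sub>\<infinity>i. (r powr p) ^ nat \<bar>i\<bar> * norm (y i n) powr p)" for n
    proof -
      have "norm (x n) powr p \<le> (k * (\<Sum>\<^sub>\<infinity>i. (r ^ 2) ^ nat \<bar>i\<bar> * norm (y i n))) powr p"
        using x[of n] p r by (intro powr_mono2) auto
      also have "\<dots> = k powr p * (\<Sum>\<^sub>\<infinity>i. (r ^ 2) ^ nat \<bar>i\<bar> * norm (y i n)) powr p"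
        by (rule powr_mult)
      also have "\<dots> \<le> G1 * (\<Sum>\<^sub>\<infinity>i. (r powr p) ^ nat \<bar>i\<bar> * norm (y i n) powr p)"
        unfolding G1_def mult.assoc
        by (intro mult_left_mono infsum_geometric_weighted_powr_le[where Z = Z]) (use r p y_le in auto)
      finally show ?thesis .
    qed
    have sum_le: "(\<Sum>n\<in>F. norm (x n) powr p) \<le> G1 * G2 * Z powr p" if F: "finite F" for F
    proof -
      have "(\<Sum>n\<in>F. norm (x n) powr p)
        \<le> G1 * (\<Sum>n\<in>F. \<Sum>\<^sub>\<infinity>i. (r powr p) ^ nat \<bar>i\<bar> * norm (y i n) powr p)"
        unfolding sum_distrib_left by (intro sum_mono x_powr)
      also have "(\<Sum>n\<in>F. \<Sum>\<^sub>\<infinity>i. (r powr p) ^ nat \<bar>i\<bar> * norm (y i n) powr p)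
        = (\<Sum>\<^sub>\<infinity>i. \<Sum>n\<in>F. (r powr p) ^ nat \<bar>i\<bar> * norm (y i n) powr p)"
        by (intro infsumI[symmetric] has_sum_finite_sum has_sum_infsum sw)
      also have "\<dots> \<le> (\<Sum>\<^sub>\<infinity>i::int. (r powr p) ^ nat \<bar>i\<bar> * Z powr p)"
      proof (rule infsum_mono)
        show "(\<lambda>i. \<Sum>n\<in>F. (r powr p) ^ nat \<bar>i\<bar> * norm (y i n) powr p) summable_on UNIV"
          by (rule has_sum_imp_summable[OF has_sum_finite_sum]) (rule has_sum_infsum[OF sw])
        show "(\<lambda>i::int. (r powr p) ^ nat \<bar>i\<bar> * Z powr p) summable_on UNIV"
          by (intro summable_on_cmult_left geometric_summable_on_int rp)
        show "(\<Sum>n\<in>F. (r powr p) ^ nat \<bar>i\<bar> * norm (y i n) powr p) \<le> (r powr p) ^ nat \<bar>i\<bar> * Z powr p"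
          for i :: int
          unfolding sum_distrib_left[symmetric] by (intro mult_left_mono finite_le F) simp
      qed
      also have "\<dots> = G2 * Z powr p" unfolding G2_def by (rule infsum_cmult_left')
      finally show ?thesis using G1 by (simp add: mult.assoc mult_left_mono)
    qed
    have x_sm: "(\<lambda>n. norm (x n) powr p) summable_on UNIV"
      by (rule nonneg_bdd_above_summable_on) (auto intro!: bdd_aboveI2 sum_le)
    have "(\<Sum>\<^sub>\<infinity>n. norm (x n) powr p) \<le> G1 * G2 * Z powr p"
      by (intro infsum_le_finite_sums x_sm sum_le)
    then have "lp_norm p x \<le> (G1 * G2 * Z powr p) powr (1 / p)"
      unfolding lp_norm_def using p by (intro powr_mono2) (auto intro: infsum_nonneg)
    also have "\<dots> = (G1 * G2) powr (1 / p) * Z"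
      using G1 G2 Z0 p by (simp add: powr_mult powr_powr)
    also have "\<dots> \<le> D * Z" using Z0 by (simp add: D_def algebra_simps)
    finally show ?thesis using x_sm by (simp add: lp_def)
  qed
  have "0 < D" by (simp add: D_def add_nonneg_pos)
  then show ?thesis using main by blast
qed

section \<open>Scalar difference equations and their Green function\<close>

lemma to_complex_zero [simp]: "to_complex (0 :: 'k::real_or_complex) = 0"
  using to_complex_add[of "0 :: 'k" 0] by simp

lemma to_complex_diff: "to_complex (a - b :: 'k::real_or_complex) = to_complex a - to_complex b"
  using to_complex_add[of "a - b" b] by simp

lemma to_complex_inject: "to_complex a = to_complex b \<longleftrightarrow> (a :: 'k::real_or_complex) = b"
  using norm_to_complex[of "a - b"] by (auto simp: to_complex_diff)

text \<open>
  The class of scalars is not a class of complete spaces, so sums are taken in the complex numbers; the range of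
  the embedding is closed, so they come from scalars.
\<close>

definition scalar_infsum :: "('i \<Rightarrow> 'k::real_or_complex) \<Rightarrow> 'i set \<Rightarrow> 'k"
  where "scalar_infsum f X = (THE s. to_complex s = (\<Sum>\<^sub>\<infinity>i\<in>X. to_complex (f i)))"

lemma to_complex_scalar_infsum:
  fixes f :: "'i \<Rightarrow> 'k::real_or_complex"
  assumes "(\<lambda>i. norm (f i)) summable_on X"
  shows "(\<lambda>i. to_complex (f i)) summable_on X"
    and "to_complex (scalar_infsum f X) = (\<Sum>\<^sub>\<infinity>i\<in>X. to_complex (f i))"
proof -
  show sm: "(\<lambda>i. to_complex (f i)) summable_on X"
    by (rule abs_summable_summable) (simp add: norm_to_complex assms)
  have closed: "closed (range (to_complex :: 'k \<Rightarrow> complex))"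
    using range_to_complex[where 'a = 'k] closed_complex_Reals by auto
  have sum_eq: "(\<Sum>i\<in>F. to_complex (f i)) = to_complex (\<Sum>i\<in>F. f i)" for F
    by (induction F rule: infinite_finite_induct) (auto simp: to_complex_add)
  have "((\<lambda>i. to_complex (f i)) has_sum (\<Sum>\<^sub>\<infinity>i\<in>X. to_complex (f i))) X"
    using sm by (rule has_sum_infsum)
  then have "(\<Sum>\<^sub>\<infinity>i\<in>X. to_complex (f i)) \<in> range (to_complex :: 'k \<Rightarrow> complex)"
    unfolding has_sum_def
    by (rule Lim_in_closed_set[OF closed _ finite_subsets_at_top_neq_bot, rotated])
      (simp add: sum_eq)
  then obtain s :: 'k where s: "(\<Sum>\<^sub>\<infinity>i\<in>X. to_complex (f i)) = to_complex s"
    by (rule rangeE)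
  show "to_complex (scalar_infsum f X) = (\<Sum>\<^sub>\<infinity>i\<in>X. to_complex (f i))"
    unfolding scalar_infsum_def
  proof (rule theI)
    show "to_complex s = (\<Sum>\<^sub>\<infinity>i\<in>X. to_complex (f i))" by (rule s[symmetric])
    fix t :: 'k assume "to_complex t = (\<Sum>\<^sub>\<infinity>i\<in>X. to_complex (f i))"
    then have "to_complex t = to_complex s" unfolding s .
    then show "t = s" by (simp only: to_complex_inject)
  qed
qed

lemma norm_scalar_infsum_le:
  fixes f :: "'i \<Rightarrow> 'k::real_or_complex"
  assumes "(\<lambda>i. norm (f i)) summable_on X"
  shows "norm (scalar_infsum f X) \<le> (\<Sum>\<^sub>\<infinity>i\<in>X. norm (f i))"
proof -
  have "norm (to_complex (scalar_infsum f X)) \<le> (\<Sum>\<^sub>\<infinity>i\<in>X. norm (to_complex (f i)))"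
    unfolding to_complex_scalar_infsum(2)[OF assms]
    by (rule norm_infsum_bound) (simp add: norm_to_complex assms)
  then show ?thesis by (simp add: norm_to_complex)
qed

lemma scalar_infsum_insert:
  fixes f :: "'i \<Rightarrow> 'k::real_or_complex"
  assumes sm: "(\<lambda>i. norm (f i)) summable_on X" and i: "i \<notin> X"
  shows "scalar_infsum f (insert i X) = f i + scalar_infsum f X"
proof -
  have sm': "(\<lambda>i. norm (f i)) summable_on insert i X"
    using sm by (simp add: summable_on_insert_iff)
  have "to_complex (scalar_infsum f (insert i X)) = to_complex (f i + scalar_infsum f X)"
    using infsum_insert[OF to_complex_scalar_infsum(1)[OF sm] i]
    by (simp add: to_complex_scalar_infsum(2)[OF sm] to_complex_scalar_infsum(2)[OF sm'] to_complex_add)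
  then show ?thesis by (simp only: to_complex_inject)
qed

text \<open>
  The solution of \<open>f n - f (n + 1) = c n\<close> that sums over the future on \<open>P\<close> and over the past off \<open>P\<close>.
\<close>

definition green_solution :: "int set \<Rightarrow> (int \<Rightarrow> 'k::real_or_complex) \<Rightarrow> int \<Rightarrow> 'k"
  where "green_solution P c n = scalar_infsum c (P \<inter> {n..}) - scalar_infsum c ({..<n} - P)"

text \<open>
  Passing from \<open>n\<close> to \<open>n + 1\<close> moves the single index \<open>n\<close> out of the first index set or into the second one, according
  as \<open>n\<close> lies in \<open>P\<close> or not. The hypothesis \<open>dich\<close> says that along every pair of
  indices that occurs, the weight decays geometrically with the distance; it yields both the convergence of the sums
  and the bound by a convolution.
\<close>

lemma green_solution_solves:
  fixes c :: "int \<Rightarrow> 'k::real_or_complex"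
  assumes a: "\<And>j. 0 < a j" and q: "0 < q" "q < 1" and C: "0 \<le> C"
    and dich: "\<And>n j. j \<in> P \<inter> {n..} \<union> ({..<n} - P) \<Longrightarrow> a n \<le> C * q ^ nat \<bar>j - n\<bar> * a j"
    and c: "\<And>j. norm (c j) * a j \<le> s j" and s: "\<And>j. s j \<le> Z"
  shows "green_solution P c n - green_solution P c (n + 1) = c n"
    and "norm (green_solution P c n) * a n \<le> C * (\<Sum>\<^sub>\<infinity>i. q ^ nat \<bar>i\<bar> * s (n + i))"
proof -
  have s0: "0 \<le> s j" for j
  proof -
    have "0 \<le> norm (c j) * a j" using a[of j] by simp
    then show ?thesis using c[of j] by linarith
  qed
  have shift: "bij_betw (\<lambda>i. n + i) UNIV UNIV" for n :: int
    by (rule bij_betw_byWitness[where f' = "\<lambda>j. j - n"]) auto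
  have sm0: "(\<lambda>j. q ^ nat \<bar>j - n\<bar> * s j) summable_on X" for n X
  proof -
    have "(\<lambda>i. q ^ nat \<bar>i\<bar> * s (n + i)) summable_on UNIV"
      using q s0 s by (intro geometric_weighted_summable_on[where Z = Z]) auto
    then have "(\<lambda>i. q ^ nat \<bar>(n + i) - n\<bar> * s (n + i)) summable_on UNIV" by simp
    then have "(\<lambda>j. q ^ nat \<bar>j - n\<bar> * s j) summable_on UNIV"
      by (subst (asm) summable_on_reindex_bij_betw[OF shift])
    then show ?thesis by (rule summable_on_subset_banach) simp
  qed
  have le: "norm (c j) * a n \<le> C * (q ^ nat \<bar>j - n\<bar> * s j)"
    if "j \<in> P \<inter> {n..} \<union> ({..<n} - P)" for j n
  proof -
    have "norm (c j) * a n \<le> norm (c j) * (C * q ^ nat \<bar>j - n\<bar> * a j)"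
      using dich[OF that] by (intro mult_left_mono) auto
    also have "\<dots> = C * q ^ nat \<bar>j - n\<bar> * (norm (c j) * a j)" by simp
    also have "\<dots> \<le> C * q ^ nat \<bar>j - n\<bar> * s j"
      using c q C by (intro mult_left_mono) auto
    finally show ?thesis by (simp add: mult.assoc)
  qed
  have sm_a: "(\<lambda>j. norm (c j) * a n) summable_on (P \<inter> {n..} \<union> ({..<n} - P))" for n
    by (rule summable_on_comparison_test[OF summable_on_cmult_right[OF sm0]])
      (use le less_imp_le[OF a] in auto)
  have sm: "(\<lambda>j. norm (c j)) summable_on (P \<inter> {n..} \<union> ({..<n} - P))" for n
    using sm_a[of n] a[of n] summable_on_cmult_left'[of "a n" "\<lambda>j. norm (c j)"] by simp
  have smP: "(\<lambda>j. norm (c j)) summable_on (P \<inter> {n..})"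
    and smN: "(\<lambda>j. norm (c j)) summable_on ({..<n} - P)" for n
    by (rule summable_on_subset_banach[OF sm[of n]], blast)+
  show "green_solution P c n - green_solution P c (n + 1) = c n"
  proof (cases "n \<in> P")
    case True
    then have "P \<inter> {n..} = insert n (P \<inter> {n + 1..})" "{..<n + 1} - P = {..<n} - P"
      by (auto simp: order_less_le)
    then show ?thesis
      using scalar_infsum_insert[OF smP[of "n + 1"], of n] by (simp add: green_solution_def)
  next
    case False
    then have "P \<inter> {n..} = P \<inter> {n + 1..}" "{..<n + 1} - P = insert n ({..<n} - P)"
      by (auto simp: order_less_le add1_zle_eq)
    then show ?thesis
      using scalar_infsum_insert[OF smN[of n], of n] by (simp add: green_solution_def)
  qed
  have "norm (green_solution P c n)
    \<le> (\<Sum>\<^sub>\<infinity>j\<in>P \<inter> {n..}. norm (c j)) + (\<Sum>\<^sub>\<infinity>j\<in>{..<n} - P. norm (c j))"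
    unfolding green_solution_def
    using norm_scalar_infsum_le[OF smP[of n]] norm_scalar_infsum_le[OF smN[of n]]
    by (intro order_trans[OF norm_triangle_ineq4] add_mono)
  also have "\<dots> = (\<Sum>\<^sub>\<infinity>j\<in>P \<inter> {n..} \<union> ({..<n} - P). norm (c j))"
    by (rule infsum_Un_disjoint[symmetric]) (use smP smN in auto)
  finally have "norm (green_solution P c n) * a n
    \<le> (\<Sum>\<^sub>\<infinity>j\<in>P \<inter> {n..} \<union> ({..<n} - P). norm (c j)) * a n"
    using a[of n] by (intro mult_right_mono) auto
  also have "\<dots> = (\<Sum>\<^sub>\<infinity>j\<in>P \<inter> {n..} \<union> ({..<n} - P). norm (c j) * a n)"
    by (rule infsum_cmult_left'[symmetric])
  also have "\<dots> \<le> (\<Sum>\<^sub>\<infinity>j. C * (q ^ nat \<bar>j - n\<bar> * s j))"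
    by (rule infsum_mono_neutral[OF sm_a summable_on_cmult_right[OF sm0]])
      (use le C q s0 in auto)
  also have "\<dots> = C * (\<Sum>\<^sub>\<infinity>j. q ^ nat \<bar>j - n\<bar> * s j)"
    by (rule infsum_cmult_right')
  also have "(\<Sum>\<^sub>\<infinity>j. q ^ nat \<bar>j - n\<bar> * s j) = (\<Sum>\<^sub>\<infinity>i. q ^ nat \<bar>i\<bar> * s (n + i))"
    using infsum_reindex_bij_betw[OF shift[of n], of "\<lambda>j. q ^ nat \<bar>j - n\<bar> * s j"] by simp
  finally show "norm (green_solution P c n) * a n \<le> C * (\<Sum>\<^sub>\<infinity>i. q ^ nat \<bar>i\<bar> * s (n + i))" .
qed

text \<open>
  The future must be summed where \<open>a\<close> increases and the past where it decreases, so \<open>P\<close> consists of the region of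
  increase. In the mixed case, an index \<open>j < 0\<close> occurs only for \<open>n \<le> j\<close> and an index \<open>j \<ge> 0\<close> only for
  \<open>n > j\<close>, so no pair straddles the origin.
\<close>

lemma green_kernel_of_exponential:
  assumes pos: "\<And>j. 0 < a j"
    and growth: "exp_increasing_on UNIV a \<or> exp_decreasing_on UNIV a \<or>
      exp_increasing_on {..-1} a \<and> exp_decreasing_on {0..} a"
  shows "\<exists>P C q. 0 < q \<and> q < 1 \<and> 0 \<le> C \<and>
    (\<forall>n j. j \<in> P \<inter> {n..} \<union> ({..<n} - P) \<longrightarrow> a n \<le> C * q ^ nat \<bar>j - n\<bar> * a j)"
proof -
  have incr: "\<exists>C q. 0 < q \<and> q < 1 \<and> 0 \<le> C \<and> (\<forall>n j. n \<in> U \<longrightarrow> j \<in> U \<longrightarrow> n \<le> j \<longrightarrow>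
      a n \<le> C * q ^ nat \<bar>j - n\<bar> * a j)" if U: "exp_increasing_on U a" for U
  proof -
    from U obtain C q where q: "0 < q" "q < 1"
      and h: "\<And>j n. j \<in> U \<Longrightarrow> j + int n \<in> U \<Longrightarrow> a j \<le> C * q ^ n * a (j + int n)"
      unfolding exp_increasing_on_def by blast
    have "a n \<le> max C 0 * q ^ nat \<bar>j - n\<bar> * a j" if "n \<in> U" "j \<in> U" "n \<le> j" for n j
    proof -
      have "a n \<le> C * q ^ nat \<bar>j - n\<bar> * a j" using h[of n "nat (j - n)"] that by simp
      also have "\<dots> \<le> max C 0 * q ^ nat \<bar>j - n\<bar> * a j"
        using q pos[of j] by (intro mult_right_mono) auto
      finally show ?thesis .
    qed
    then show ?thesis using q by (intro exI[of _ "max C 0"] exI[of _ q]) auto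
  qed
  have decr: "\<exists>C q. 0 < q \<and> q < 1 \<and> 0 \<le> C \<and> (\<forall>n j. n \<in> U \<longrightarrow> j \<in> U \<longrightarrow> j \<le> n \<longrightarrow>
      a n \<le> C * q ^ nat \<bar>j - n\<bar> * a j)" if U: "exp_decreasing_on U a" for U
  proof -
    from U obtain C q where q: "0 < q" "q < 1"
      and h: "\<And>j n. j \<in> U \<Longrightarrow> j + int n \<in> U \<Longrightarrow> a (j + int n) \<le> C * q ^ n * a j"
      unfolding exp_decreasing_on_def by blast
    have "a n \<le> max C 0 * q ^ nat \<bar>j - n\<bar> * a j" if "n \<in> U" "j \<in> U" "j \<le> n" for n j
    proof -
      have "a n \<le> C * q ^ nat \<bar>j - n\<bar> * a j" using h[of j "nat (n - j)"] that by (simp add: abs_minus_commute)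
      also have "\<dots> \<le> max C 0 * q ^ nat \<bar>j - n\<bar> * a j"
        using q pos[of j] by (intro mult_right_mono) auto
      finally show ?thesis .
    qed
    then show ?thesis using q by (intro exI[of _ "max C 0"] exI[of _ q]) auto
  qed
  consider "exp_increasing_on UNIV a" | "exp_decreasing_on UNIV a"
    | "exp_increasing_on {..-1} a" "exp_decreasing_on {0..} a" using growth by blast
  then show ?thesis
  proof cases
    case 1
    then obtain C q where "0 < q \<and> q < 1 \<and> 0 \<le> C" "\<And>n j. n \<le> j \<Longrightarrow> a n \<le> C * q ^ nat \<bar>j - n\<bar> * a j"
      using incr[of UNIV] by auto
    then show ?thesis by (intro exI[of _ UNIV] exI[of _ C] exI[of _ q]) auto
  next
    case 2
    then obtain C q where "0 < q \<and> q < 1 \<and> 0 \<le> C" "\<And>n j. j \<le> n \<Longrightarrow> a n \<le> C * q ^ nat \<bar>j - n\<bar> * a j"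
      using decr[of UNIV] by auto
    then show ?thesis by (intro exI[of _ "{}"] exI[of _ C] exI[of _ q]) auto
  next
    case 3
    obtain C q where q: "0 < q" "q < 1" "0 \<le> C"
      and h: "\<And>n j. n \<le> -1 \<Longrightarrow> j \<le> -1 \<Longrightarrow> n \<le> j \<Longrightarrow> a n \<le> C * q ^ nat \<bar>j - n\<bar> * a j"
      using incr[OF 3(1)] by auto
    obtain C' q' where q': "0 < q'" "q' < 1" "0 \<le> C'"
      and h': "\<And>n j. 0 \<le> n \<Longrightarrow> 0 \<le> j \<Longrightarrow> j \<le> n \<Longrightarrow> a n \<le> C' * q' ^ nat \<bar>j - n\<bar> * a j"
      using decr[OF 3(2)] by auto
    define R where "R = max q q'"
    have R: "0 < R" "R < 1" using q q' by (auto simp: R_def)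
    have "a n \<le> max C C' * R ^ nat \<bar>j - n\<bar> * a j" if "j \<in> {..-1} \<inter> {n..} \<union> ({..<n} - {..-1})" for n j
    proof (cases "j \<le> -1")
      case True
      then have "a n \<le> C * q ^ nat \<bar>j - n\<bar> * a j" using h[of n j] that by auto
      also have "\<dots> \<le> max C C' * R ^ nat \<bar>j - n\<bar> * a j"
        using q R pos[of j] by (intro mult_right_mono mult_mono power_mono) (auto simp: R_def)
      finally show ?thesis .
    next
      case False
      then have "a n \<le> C' * q' ^ nat \<bar>j - n\<bar> * a j" using h'[of n j] that by auto
      also have "\<dots> \<le> max C C' * R ^ nat \<bar>j - n\<bar> * a j"
        using q' R pos[of j] by (intro mult_right_mono mult_mono power_mono) (auto simp: R_def)
      finally show ?thesis .
    qed
    then show ?thesis using R q(3)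
      by (intro exI[of _ "{..-1}"] exI[of _ "max C C'"] exI[of _ R]) auto
  qed
qed

section \<open>Linear maps on a finite-dimensional Hilbert space\<close>

context fin_dim_hilbert_space
begin

lemma ip_zero_left [simp]: "ip 0 y = 0"
  using ip_add_left[of 0 0 y] by simp

lemma ip_orthogonal_sym: "ip x y = 0 \<Longrightarrow> ip y x = 0"
  using ip_conj_sym[of y x] to_complex_inject[of "ip y x" 0] by simp

lemma ip_add_right: "ip x (y + z) = ip x y + ip x z"
proof -
  have "to_complex (ip x (y + z)) = cnj (to_complex (ip (y + z) x))" by (rule ip_conj_sym)
  also have "\<dots> = to_complex (ip x y) + to_complex (ip x z)"
    unfolding ip_conj_sym[of x y] ip_conj_sym[of x z] by (simp add: ip_add_left to_complex_add)
  also have "\<dots> = to_complex (ip x y + ip x z)" by (simp add: to_complex_add)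
  finally show ?thesis by (simp only: to_complex_inject)
qed

lemma ip_diff_left: "ip (x - y) z = ip x z - ip y z"
  using ip_add_left[of "x - y" y z] by simp

lemma norm_ip_self: "norm (ip x x) = (norm x)\<^sup>2"
  by (simp add: ip_self del: of_real_power)

lemma norm_ip_sym: "norm (ip x y) = norm (ip y x)"
  using ip_conj_sym[of x y] by (metis complex_mod_cnj norm_to_complex)

lemma norm_cscale: "norm (cscale c x) = norm c * norm x"
proof -
  have "(norm (cscale c x))\<^sup>2 = norm c * norm (ip x (cscale c x))"
    by (simp add: ip_scale_left norm_mult flip: norm_ip_self)
  also have "\<dots> = (norm c * norm x)\<^sup>2"
    unfolding norm_ip_sym[of x]
    by (simp add: ip_scale_left norm_mult norm_ip_self power2_eq_square mult_ac)
  finally show ?thesis by (simp add: power2_eq_iff_nonneg)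
qed

text \<open>
  By the theorem of Pythagoras; taking for \<open>u\<close> a multiple of a fixed vector bounds a coordinate.
\<close>

lemma norm_le_norm_add_orthogonal:
  assumes "ip u v = 0"
  shows "norm u \<le> norm (u + v)"
proof -
  have "ip (u + v) (u + v) = ip u u + ip v v"
    by (simp add: ip_add_left ip_add_right assms ip_orthogonal_sym[OF assms])
  then have "(norm (u + v))\<^sup>2 = (norm u)\<^sup>2 + (norm v)\<^sup>2"
    by (simp only: ip_self of_real_eq_iff flip: of_real_add)
  then have "(norm u)\<^sup>2 \<le> (norm (u + v))\<^sup>2" by simp
  then show ?thesis by (rule power2_le_imp_le) simp
qed

lemma orthogonal_to_span:
  assumes "\<And>c. c \<in> F \<Longrightarrow> ip c y = 0" "w \<in> span F"
  shows "ip w y = 0"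
  using assms(2)
  by (induction rule: span_induct_alt) (auto simp: ip_add_left ip_scale_left assms(1))

text \<open>
  One step of the Gram-Schmidt process: \<open>u = d - v\<close> is the part of the new vector \<open>d\<close> that is orthogonal to \<open>F\<close>.
  If \<open>u = 0\<close>, then the quotient below is 0 and the old projection remains correct.
\<close>

lemma orthogonal_projection_exists:
  assumes "finite F"
  shows "\<exists>w\<in>span F. \<forall>c\<in>F. ip (y - w) c = 0"
  using assms
proof (induction F arbitrary: y)
  case empty
  show ?case by (auto simp: span_zero)
next
  case (insert d F)
  obtain w where w: "w \<in> span F" "\<And>c. c \<in> F \<Longrightarrow> ip (y - w) c = 0" using insert.IH by blast
  obtain v where v: "v \<in> span F" "\<And>c. c \<in> F \<Longrightarrow> ip (d - v) c = 0" using insert.IH by blast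
  define u where "u = d - v"
  define w' where "w' = w + cscale (ip (y - w) u / ip u u) u"
  have sub: "span F \<subseteq> span (insert d F)" by (intro span_mono) auto
  have u_span: "u \<in> span (insert d F)"
    unfolding u_def using sub v(1) by (intro span_diff) (auto intro: span_base)
  have w'_span: "w' \<in> span (insert d F)"
    unfolding w'_def using sub w(1) u_span by (intro span_add span_scale) auto
  have F: "ip (y - w') c = 0" if "c \<in> F" for c
    using w(2)[OF that] v(2)[OF that]
    by (simp add: w'_def u_def ip_add_left ip_diff_left ip_scale_left diff_diff_eq[symmetric])
  have "ip (y - w') u = 0"
  proof (cases "u = 0")
    case True
    then show ?thesis using ip_orthogonal_sym[OF ip_zero_left] by simp
  next
    case False
    then have "ip u u \<noteq> 0" by (simp add: ip_self)
    then show ?thesis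
      by (simp add: w'_def ip_add_left ip_diff_left ip_scale_left diff_diff_eq[symmetric])
  qed
  moreover have "ip (y - w') v = 0"
  proof -
    have "ip v (y - w') = 0" using F ip_orthogonal_sym by (intro orthogonal_to_span[OF _ v(1)]) blast
    then show ?thesis by (rule ip_orthogonal_sym)
  qed
  ultimately have "ip (y - w') d = 0"
    using ip_add_right[of "y - w'" u v] by (simp add: u_def)
  then show ?case using F w'_span by blast
qed

lemma is_basis_finite: "is_basis cscale B \<Longrightarrow> finite B"
  using fin_dim independent_span_bound unfolding is_basis_def by (metis subset_UNIV)

text \<open>
  Let \<open>u\<close> be the part of \<open>b\<close> orthogonal to the other basis vectors. Every \<open>y\<close> is its \<open>b\<close>-coordinate times \<open>u\<close> plus a vector
  orthogonal to \<open>u\<close>, so the coordinate is at most \<open>\<parallel>y\<parallel> / \<parallel>u\<parallel>\<close>.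
\<close>

lemma representation_bounded:
  assumes B: "is_basis cscale B" and b: "b \<in> B"
  shows "\<exists>K. \<forall>y. norm (representation B y b) \<le> K * norm y"
proof -
  have ind: "independent B" and sp: "span B = UNIV" using B by (auto simp: is_basis_def)
  have fin: "finite B" by (rule is_basis_finite[OF B])
  obtain w where w: "w \<in> span (B - {b})" "\<And>c. c \<in> B - {b} \<Longrightarrow> ip (b - w) c = 0"
    using orthogonal_projection_exists[of "B - {b}" b] fin by auto
  define u where "u = b - w"
  have "b \<notin> span (B - {b})" using ind b by (auto simp: dependent_def)
  then have u0: "u \<noteq> 0" using w(1) by (auto simp: u_def)
  have orth: "ip u v = 0" if "v \<in> span (B - {b})" for v
    by (rule ip_orthogonal_sym, rule orthogonal_to_span[OF _ that], rule ip_orthogonal_sym)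
      (use w(2) u_def in auto)
  have "norm (representation B y b) \<le> (1 / norm u) * norm y" for y
  proof -
    define \<alpha> where "\<alpha> = representation B y b"
    define v where "v = cscale \<alpha> w + (\<Sum>c\<in>B - {b}. cscale (representation B y c) c)"
    have "y = (\<Sum>c\<in>B. cscale (representation B y c) c)"
      using sum_representation_eq[OF ind, of y B] sp fin by simp
    also have "\<dots> = cscale \<alpha> b + (\<Sum>c\<in>B - {b}. cscale (representation B y c) c)"
      using fin b by (simp add: sum.remove \<alpha>_def)
    also have "\<dots> = cscale \<alpha> u + v" by (simp add: u_def v_def scale_right_diff_distrib)
    finally have y: "y = cscale \<alpha> u + v" .
    have "v \<in> span (B - {b})"
      unfolding v_def using w(1) by (intro span_add span_scale span_sum) (auto intro: span_base)
    then have "ip (cscale \<alpha> u) v = 0" by (simp add: ip_scale_left orth)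
    then have "norm (cscale \<alpha> u) \<le> norm y" unfolding y by (rule norm_le_norm_add_orthogonal)
    then show ?thesis using u0 by (simp add: norm_cscale \<alpha>_def field_simps)
  qed
  then show ?thesis by blast
qed

lemma finite_dim_basis_exists: "\<exists>B. is_basis cscale B"
  using maximal_independent_subset[of UNIV] unfolding is_basis_def
  by (metis top.extremum_uniqueI)

text \<open>
  Boundedness is what gives the operator norm its meaning: for an unbounded map the supremum that defines
  \<open>onorm\<close> would bound nothing.
\<close>

lemma linear_imp_bounded_linear:
  assumes f: "Vector_Spaces.linear cscale cscale f"
  shows "bounded_linear f"
proof -
  interpret f: Vector_Spaces.linear cscale cscale f by (rule f)
  obtain B where B: "is_basis cscale B" using finite_dim_basis_exists by blast
  have ind: "independent B" and sp: "span B = UNIV" using B by (auto simp: is_basis_def)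
  have fin: "finite B" by (rule is_basis_finite[OF B])
  obtain K where K: "\<And>b y. b \<in> B \<Longrightarrow> norm (representation B y b) \<le> K b * norm y"
    using representation_bounded[OF B] by metis
  show ?thesis
  proof (rule bounded_linear_intro)
    show "f (x + y) = f x + f y" for x y by (rule f.add)
    show "f (r *\<^sub>R x) = r *\<^sub>R f x" for r x
      using f.scale[of "of_real r" x] by (simp add: scale_of_real)
    fix y
    have "f y = f (\<Sum>b\<in>B. cscale (representation B y b) b)"
      using sum_representation_eq[OF ind, of y B] sp fin by simp
    also have "\<dots> = (\<Sum>b\<in>B. cscale (representation B y b) (f b))"
      by (simp add: f.sum f.scale)
    also have "norm \<dots> \<le> (\<Sum>b\<in>B. (K b * norm y) * norm (f b))"
      by (intro order_trans[OF norm_sum] sum_mono) (auto simp: norm_cscale intro!: mult_right_mono K)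
    also have "\<dots> = norm y * (\<Sum>b\<in>B. K b * norm (f b))"
      by (simp add: sum_distrib_left mult_ac)
    finally show "norm (f y) \<le> norm y * (\<Sum>b\<in>B. K b * norm (f b))" .
  qed
qed

end

section \<open>Orbits of the operators\<close>

lemma foldr_comp_eq: "foldr (\<lambda>i f. S i \<circ> f) xs g = foldr (\<lambda>i f. S i \<circ> f) xs id \<circ> g"
  by (induction xs) auto

lemma op_prod_empty: "m < n \<Longrightarrow> op_prod S n m = id"
  by (simp add: op_prod_def)

lemma op_prod_left: "n \<le> m \<Longrightarrow> op_prod S n m = S n \<circ> op_prod S (n + 1) m"
  by (simp add: op_prod_def upto_rec1)

lemma op_prod_right: "n \<le> m \<Longrightarrow> op_prod S n m = op_prod S n (m - 1) \<circ> S m"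
  by (simp add: op_prod_def upto_rec2 foldr_comp_eq[of S _ "S m"])

text \<open>
  The propagator along the backward equation \<open>S\<^sub>n v\<^sub>n = v\<^sub>n\<^sub>-\<^sub>1\<close>: it maps the value at 0 to the value at \<open>n\<close>
  (lemma \<open>S_orbit\<close> below). Its normalized values are the vectors \<open>e_vec S n x\<close>.
\<close>

definition orbit :: "(int \<Rightarrow> 'x \<Rightarrow> 'x) \<Rightarrow> int \<Rightarrow> 'x \<Rightarrow> 'x"
  where "orbit S n = (if 0 \<le> n then inv (op_prod S 1 n) else op_prod S (n + 1) 0)"

lemma orbit_nonneg: "0 \<le> n \<Longrightarrow> orbit S n = inv (op_prod S 1 n)"
  and orbit_neg: "n < 0 \<Longrightarrow> orbit S n = op_prod S (n + 1) 0"
  by (auto simp: orbit_def)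

lemma orbit_nonpos: "n \<le> 0 \<Longrightarrow> orbit S n = op_prod S (n + 1) 0"
  by (cases "n = 0") (auto simp: orbit_def op_prod_empty)

lemma e_vec_eq_orbit: "e_vec S n x = orbit S n x /\<^sub>R norm (orbit S n x)"
  by (simp add: e_vec_def orbit_def)

lemma condA_iff:
  assumes "bounded_ratios (\<lambda>n. norm (orbit S n x)) C"
  shows "condA S x \<longleftrightarrow> exp_increasing_on UNIV (\<lambda>n. norm (orbit S n x))"
  unfolding bounded_ratios.window_sup_limit_iff[OF assms, symmetric] condA_def
  by (intro ex_cong1 conj_cong refl arg_cong[of _ _ "\<lambda>f. f \<longlonglongrightarrow> _"] ext
      arg_cong[of _ _ "\<lambda>q. q powr _"] arg_cong[of _ _ Max] arg_cong2[of _ _ _ _ insert] SUP_cong)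
    (auto simp: orbit_nonneg orbit_neg)

lemma condB_iff:
  assumes "bounded_ratios (\<lambda>n. norm (orbit S n x)) C"
  shows "condB S x \<longleftrightarrow> exp_decreasing_on UNIV (\<lambda>n. norm (orbit S n x))"
  unfolding bounded_ratios.window_inf_limit_iff[OF assms, symmetric] condB_def
  by (intro ex_cong1 conj_cong refl arg_cong[of _ _ "\<lambda>f. f \<longlonglongrightarrow> _"] ext
      arg_cong[of _ _ "\<lambda>q. q powr _"] arg_cong[of _ _ Min] arg_cong2[of _ _ _ _ insert] INF_cong)
    (auto simp: orbit_nonneg orbit_neg)

lemma condC_iff:
  assumes "bounded_ratios (\<lambda>n. norm (orbit S n x)) C"
  shows "condC S x \<longleftrightarrow> exp_increasing_on {..-1} (\<lambda>n. norm (orbit S n x)) \<and>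
    exp_decreasing_on {0..} (\<lambda>n. norm (orbit S n x))"
  unfolding bounded_ratios.negative_sup_limit_iff[OF assms, symmetric]
    bounded_ratios.positive_inf_limit_iff[OF assms, symmetric] condC_def
  by (intro ex_cong1 conj_cong refl arg_cong[of _ _ "\<lambda>f. f \<longlonglongrightarrow> _"] ext SUP_cong INF_cong)
    (auto simp: orbit_nonneg orbit_neg)

section \<open>Coordinates along the orbits\<close>

locale invertible_operator_sequence = fin_dim_hilbert_space cscale ip
  for cscale :: "'k::real_or_complex \<Rightarrow> 'x::real_normed_vector \<Rightarrow> 'x" and ip +
  fixes S :: "int \<Rightarrow> 'x \<Rightarrow> 'x" and E :: "'x set" and C\<^sub>0 :: real
  assumes linear_S: "\<And>n. Vector_Spaces.linear cscale cscale (S n)"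
    and bij_S: "\<And>n. bij (S n)"
    and onorm_S: "\<And>n. onorm (S n) \<le> C\<^sub>0"
    and onorm_inv_S: "\<And>n. onorm (inv (S n)) \<le> C\<^sub>0"
    and basis: "is_basis cscale E"
begin

lemma linear_iff_scale_add:
  "Vector_Spaces.linear cscale cscale f \<longleftrightarrow>
    (\<forall>x y. f (x + y) = f x + f y) \<and> (\<forall>c x. f (cscale c x) = cscale c (f x))"
  using vector_space_axioms by (simp add: Vector_Spaces.linear_iff)

lemma linear_inv:
  assumes f: "Vector_Spaces.linear cscale cscale f" and bij: "bij f"
  shows "Vector_Spaces.linear cscale cscale (inv f)"
proof -
  have inj: "inj f" and f_inv: "\<And>y. f (inv f y) = y"
    using bij by (auto simp: bij_is_inj bij_is_surj surj_f_inv_f)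
  have "inv f (x + y) = inv f x + inv f y" for x y
    using f by (intro inv_f_eq inj) (simp add: linear_iff_scale_add f_inv)
  moreover have "inv f (cscale c x) = cscale c (inv f x)" for c x
    using f by (intro inv_f_eq inj) (simp add: linear_iff_scale_add f_inv)
  ultimately show ?thesis by (simp add: linear_iff_scale_add)
qed

lemma op_prod_linear_bij:
  "Vector_Spaces.linear cscale cscale (op_prod S n m) \<and> bij (op_prod S n m)"
proof (cases "n \<le> m")
  case True
  then show ?thesis
  proof (induction m rule: int_ge_induct)
    case base
    show ?case using linear_S bij_S by (simp add: op_prod_right op_prod_empty)
  next
    case (step m)
    have comp: "Vector_Spaces.linear cscale cscale (f \<circ> g)"
      if "Vector_Spaces.linear cscale cscale f" "Vector_Spaces.linear cscale cscale g" for f g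
      using that by (simp add: linear_iff_scale_add)
    have "op_prod S n (m + 1) = op_prod S n m \<circ> S (m + 1)"
      using step.hyps by (simp add: op_prod_right)
    then show ?case using step.IH linear_S bij_S by (simp only: comp bij_comp)
  qed
next
  case False
  have "Vector_Spaces.linear cscale cscale id" by (simp add: linear_iff_scale_add)
  then show ?thesis using False by (simp only: op_prod_empty bij_id not_le)
qed

lemma linear_orbit: "Vector_Spaces.linear cscale cscale (orbit S n)"
  and bij_orbit: "bij (orbit S n)"
  using op_prod_linear_bij linear_inv by (auto simp: orbit_def bij_imp_bij_inv)

lemma S_orbit: "S n (orbit S n x) = orbit S (n - 1) x"
proof (cases "1 \<le> n")
  case True
  have "inv (op_prod S 1 n) = inv (S n) \<circ> inv (op_prod S 1 (n - 1))"
    using True bij_S op_prod_linear_bij by (simp add: op_prod_right[of 1 n] o_inv_distrib)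
  then show ?thesis using True bij_S
    by (simp add: orbit_nonneg bij_is_surj surj_f_inv_f)
next
  case False
  then show ?thesis by (simp add: orbit_nonpos op_prod_left[of n 0])
qed

lemma basis_nonzero: "b \<in> E \<Longrightarrow> b \<noteq> 0"
  using basis dependent_zero by (auto simp: is_basis_def)

lemma orbit_nonzero: "b \<in> E \<Longrightarrow> orbit S n b \<noteq> 0"
proof
  assume b: "b \<in> E" and "orbit S n b = 0"
  moreover interpret o: Vector_Spaces.linear cscale cscale "orbit S n" by (rule linear_orbit)
  have "orbit S n 0 = 0" by (rule o.zero)
  ultimately have "b = 0" using bij_orbit[of n] by (metis bij_is_inj injD)
  then show False using basis_nonzero[OF b] by simp
qed

lemma bounded_ratios_orbit:
  assumes b: "b \<in> E"
  shows "bounded_ratios (\<lambda>n. norm (orbit S n b)) C\<^sub>0"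
proof
  show "0 < norm (orbit S j b)" for j using orbit_nonzero[OF b] by simp
  fix j
  have eq: "S (j + 1) (orbit S (j + 1) b) = orbit S j b" using S_orbit[of "j + 1"] by simp
  have "norm (S (j + 1) (orbit S (j + 1) b)) \<le> onorm (S (j + 1)) * norm (orbit S (j + 1) b)"
    by (rule onorm[OF linear_imp_bounded_linear[OF linear_S]])
  also have "\<dots> \<le> C\<^sub>0 * norm (orbit S (j + 1) b)" by (intro mult_right_mono onorm_S) simp
  finally show "norm (orbit S j b) \<le> C\<^sub>0 * norm (orbit S (j + 1) b)" by (simp add: eq)
  have inv_eq: "inv (S (j + 1)) (orbit S j b) = orbit S (j + 1) b"
    using bij_S by (simp add: bij_is_inj flip: eq)
  have "norm (inv (S (j + 1)) (orbit S j b)) \<le> onorm (inv (S (j + 1))) * norm (orbit S j b)"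
    by (rule onorm[OF linear_imp_bounded_linear[OF linear_inv[OF linear_S bij_S]]])
  also have "\<dots> \<le> C\<^sub>0 * norm (orbit S j b)" by (intro mult_right_mono onorm_inv_S) simp
  finally show "norm (orbit S (j + 1) b) \<le> C\<^sub>0 * norm (orbit S j b)" by (simp add: inv_eq)
qed

text \<open>
  The coefficient of \<open>y\<close> along \<open>orbit S n b\<close> in the basis \<open>orbit S n ` E\<close>. Pulling back to \<open>E\<close> makes these
  coefficients for different \<open>n\<close> comparable.
\<close>

definition coord :: "int \<Rightarrow> 'x \<Rightarrow> 'x \<Rightarrow> 'k"
  where "coord n b y = representation E (inv (orbit S n) y) b"

lemma E_independent: "independent E" and E_span: "span E = UNIV" and E_finite: "finite E"
  using basis is_basis_finite by (auto simp: is_basis_def)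

lemma coord_add: "coord n b (y + z) = coord n b y + coord n b z"
  and coord_scale: "coord n b (cscale c y) = c * coord n b y"
  using linear_inv[OF linear_orbit bij_orbit, of n]
  by (simp_all add: coord_def linear_iff_scale_add representation_add representation_scale
      E_independent E_span)

lemma coord_diff: "coord n b (y - z) = coord n b y - coord n b z"
  using coord_add[of n b "y - z" z] by simp

lemma coord_zero [simp]: "coord n b 0 = 0"
  using coord_add[of n b 0 0] by simp

lemma coord_sum: "coord n b (\<Sum>i\<in>I. f i) = (\<Sum>i\<in>I. coord n b (f i))"
  by (induction I rule: infinite_finite_induct) (auto simp: coord_add)

lemma coord_orbit: "c \<in> E \<Longrightarrow> coord n b (orbit S n c) = (if b = c then 1 else 0)"
  using bij_orbit by (simp add: coord_def bij_is_inj representation_basis E_independent)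

lemma sum_coord: "(\<Sum>b\<in>E. cscale (coord n b y) (orbit S n b)) = y"
proof -
  interpret o: Vector_Spaces.linear cscale cscale "orbit S n" by (rule linear_orbit)
  have "(\<Sum>b\<in>E. cscale (coord n b y) (orbit S n b))
      = orbit S n (\<Sum>b\<in>E. cscale (representation E (inv (orbit S n) y) b) b)"
    by (simp add: o.sum o.scale coord_def)
  also have "\<dots> = orbit S n (inv (orbit S n) y)"
    using sum_representation_eq[OF E_independent, of "inv (orbit S n) y" E] E_finite E_span by simp
  also have "\<dots> = y" using bij_orbit by (simp add: bij_is_surj surj_f_inv_f)
  finally show ?thesis .
qed

text \<open>
  In these coordinates the shift does not change coefficients; this is the decoupling of the shadowing equation.
\<close>

lemma coord_S: "coord (n - 1) b (S n y) = coord n b y"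
proof -
  have "orbit S (n - 1) (inv (orbit S n) y) = S n y"
    using bij_orbit by (simp add: bij_is_surj surj_f_inv_f flip: S_orbit)
  then have "inv (orbit S (n - 1)) (S n y) = inv (orbit S n) y"
    using bij_orbit by (intro inv_f_eq bij_is_inj)
  then show ?thesis by (simp add: coord_def)
qed

lemma scaleR_eq_cscale: "r *\<^sub>R x = cscale (of_real r) x"
  by (simp add: scale_of_real)

lemma coord_e_vec:
  "c \<in> E \<Longrightarrow> coord n b (e_vec S n c) = (if b = c then of_real (1 / norm (orbit S n c)) else 0)"
  by (simp add: e_vec_eq_orbit scaleR_eq_cscale coord_scale coord_orbit inverse_eq_divide)

lemma inj_on_e_vec: "inj_on (e_vec S n) E"
proof (rule inj_onI)
  fix b c assume bc: "b \<in> E" "c \<in> E" and eq: "e_vec S n b = e_vec S n c"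
  show "b = c"
  proof (rule ccontr)
    assume "b \<noteq> c"
    then have "coord n b (e_vec S n c) = 0" using bc by (simp add: coord_e_vec)
    then have "of_real (1 / norm (orbit S n b)) = (0 :: 'k)"
      using bc by (simp add: coord_e_vec flip: eq)
    then show False using orbit_nonzero[OF bc(1)] by simp
  qed
qed

text \<open>
  The coordinate functionals of the orbits vanish on all but one of these vectors.
\<close>

lemma independent_e_vec: "independent (e_vec S n ` E)"
proof -
  have "u (e_vec S n b) = 0"
    if "(\<Sum>v\<in>e_vec S n ` E. cscale (u v) v) = 0" and b: "b \<in> E" for u b
  proof -
    have "(\<Sum>c\<in>E. cscale (u (e_vec S n c)) (e_vec S n c)) = 0"
      using that(1) by (simp add: sum.reindex[OF inj_on_e_vec])
    then have "coord n b (\<Sum>c\<in>E. cscale (u (e_vec S n c)) (e_vec S n c)) = 0" by simp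
    moreover have "coord n b (\<Sum>c\<in>E. cscale (u (e_vec S n c)) (e_vec S n c))
        = (\<Sum>c\<in>E. if b = c then u (e_vec S n c) * of_real (1 / norm (orbit S n c)) else 0)"
      unfolding coord_sum by (intro sum.cong) (auto simp: coord_scale coord_e_vec)
    moreover have "\<dots> = u (e_vec S n b) * of_real (1 / norm (orbit S n b))"
      using E_finite b by (simp add: sum.delta')
    ultimately show ?thesis using orbit_nonzero[OF b] by simp
  qed
  then show ?thesis using E_finite by (subst dependent_finite) auto
qed

text \<open>
  Normalizing the basis vectors changes the coordinates but not the projections.
\<close>

lemma basis_proj_e_vec:
  assumes b: "b \<in> E"
  shows "basis_proj cscale (e_vec S n ` E) (e_vec S n b) y = cscale (coord n b y) (orbit S n b)"
proof -
  let ?r = "\<lambda>c. of_real (norm (orbit S n c)) :: 'k"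
  have orbit_eq: "cscale (\<alpha> * ?r c) (e_vec S n c) = cscale \<alpha> (orbit S n c)" if "c \<in> E" for \<alpha> c
    using orbit_nonzero[OF that] by (simp add: e_vec_eq_orbit scaleR_eq_cscale)
  have y: "y = (\<Sum>c\<in>E. cscale (coord n c y * ?r c) (e_vec S n c))"
    by (simp add: orbit_eq sum_coord cong: sum.cong)
  have span: "e_vec S n c \<in> span (e_vec S n ` E)" if "c \<in> E" for c
    using that by (intro span_base) auto
  have "representation (e_vec S n ` E) y (e_vec S n b)
    = (\<Sum>c\<in>E. representation (e_vec S n ` E) (cscale (coord n c y * ?r c) (e_vec S n c)) (e_vec S n b))"
    by (subst (1) y, subst representation_sum[OF independent_e_vec])
      (auto intro: span_scale span)
  also have "\<dots> = (\<Sum>c\<in>E. if c = b then coord n c y * ?r c else 0)"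
  proof (rule sum.cong[OF refl])
    fix c assume c: "c \<in> E"
    have "e_vec S n b = e_vec S n c \<longleftrightarrow> c = b" using inj_on_e_vec b c by (auto dest: inj_onD)
    then show "representation (e_vec S n ` E) (cscale (coord n c y * ?r c) (e_vec S n c)) (e_vec S n b)
      = (if c = b then coord n c y * ?r c else 0)"
      using c by (simp add: representation_scale[OF independent_e_vec span] representation_basis[OF independent_e_vec])
  qed
  also have "\<dots> = coord n b y * ?r b" using E_finite b by simp
  finally show ?thesis
    unfolding basis_proj_def by (simp add: orbit_eq[OF b])
qed

lemma coord_bound:
  assumes M: "\<And>n b. b \<in> E \<Longrightarrow> onorm (basis_proj cscale (e_vec S n ` E) (e_vec S n b)) \<le> M"
    and b: "b \<in> E"
  shows "norm (coord n b y) * norm (orbit S n b) \<le> M * norm y"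
proof -
  let ?f = "basis_proj cscale (e_vec S n ` E) (e_vec S n b)"
  have "Vector_Spaces.linear cscale cscale ?f"
    by (simp add: linear_iff_scale_add basis_proj_e_vec[OF b] coord_add coord_scale scale_left_distrib)
  then have "norm (?f y) \<le> onorm ?f * norm y" by (intro onorm linear_imp_bounded_linear)
  also have "\<dots> \<le> M * norm y" by (intro mult_right_mono M b) simp
  finally show ?thesis by (simp add: basis_proj_e_vec[OF b] norm_cscale)
qed

end

section \<open>Shadowing and exponential growth\<close>

context invertible_operator_sequence
begin

text \<open>
  For each basis vector \<open>b\<close> and each \<open>d\<close> the coefficients \<open>c b d j\<close> of the errors \<open>z (d - 1 - j)\<close> at the entry \<open>j\<close>
  form one scalar equation, which is solved by its Green function; the value at \<open>n\<close> is used at the time \<open>t = d - n\<close>. With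
  \<open>j = n + i\<close>, the error that enters is \<open>z (t - 1 - i)\<close> at the entry \<open>n + i\<close>, so \<open>x t\<close> is bounded by a convolution over \<open>i\<close>
  of shifted errors. As \<open>E\<close> is finite, one rate \<open>Q\<close> serves all basis vectors.
\<close>

lemma shadowing_if_exponential:
  assumes p: "0 < p"
    and M: "\<And>n b y. b \<in> E \<Longrightarrow> norm (coord n b y) * norm (orbit S n b) \<le> M * norm y"
    and exp: "\<And>b. b \<in> E \<Longrightarrow>
      exp_increasing_on UNIV (\<lambda>n. norm (orbit S n b)) \<or>
      exp_decreasing_on UNIV (\<lambda>n. norm (orbit S n b)) \<or>
      exp_increasing_on {..-1} (\<lambda>n. norm (orbit S n b)) \<and>
      exp_decreasing_on {0..} (\<lambda>n. norm (orbit S n b))"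
  shows "shadowing_property (lp p) (lp_norm p) (shift_op S)"
proof -
  define ker where "ker b P C q \<longleftrightarrow> 0 < q \<and> q < 1 \<and> 0 \<le> C \<and>
    (\<forall>n j. j \<in> P \<inter> {n..} \<union> ({..<n} - P) \<longrightarrow>
      norm (orbit S n b) \<le> C * q ^ nat \<bar>j - n\<bar> * norm (orbit S j b))"
    for b P and C q :: real
  have "\<exists>P C q. ker b P C q" if "b \<in> E" for b
    unfolding ker_def
    by (rule green_kernel_of_exponential[OF _ exp[OF that]]) (use orbit_nonzero[OF that] in auto)
  then obtain P C q where ker: "\<And>b. b \<in> E \<Longrightarrow> ker b (P b) (C b) (q b)"
    by metis
  have q: "0 < q b" "q b < 1" and C: "0 \<le> C b"
    and kernel: "j \<in> P b \<inter> {n..} \<union> ({..<n} - P b) \<Longrightarrow>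
      norm (orbit S n b) \<le> C b * q b ^ nat \<bar>j - n\<bar> * norm (orbit S j b)"
    if "b \<in> E" for b n j
    using ker[OF that] unfolding ker_def by blast+
  \<comment> \<open>The value 1/2 provides a rate when \<open>E\<close> is empty.\<close>
  define Q where "Q = Max (insert (1 / 2) (q ` E))"
  have q_le: "q b \<le> Q" if "b \<in> E" for b
    unfolding Q_def using E_finite that by (intro Max_ge) auto
  have Q: "0 < Q" "Q < 1"
  proof -
    have "1 / 2 \<le> Q" unfolding Q_def using E_finite by (intro Max_ge) auto
    then show "0 < Q" by linarith
    show "Q < 1" unfolding Q_def using E_finite q by (subst Max_less_iff) auto
  qed
  have kernel_Q: "norm (orbit S n b) \<le> C b * Q ^ nat \<bar>j - n\<bar> * norm (orbit S j b)"
    if "b \<in> E" "j \<in> P b \<inter> {n..} \<union> ({..<n} - P b)" for b n j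
  proof -
    have "C b * q b ^ nat \<bar>j - n\<bar> * norm (orbit S j b) \<le> C b * Q ^ nat \<bar>j - n\<bar> * norm (orbit S j b)"
      using q(1)[OF that(1)] q_le[OF that(1)] C[OF that(1)]
      by (intro mult_right_mono mult_left_mono power_mono) auto
    then show ?thesis using kernel[OF that] by linarith
  qed
  define M' where "M' = max M 0"
  have M': "norm (coord n b y) * norm (orbit S n b) \<le> M' * norm y" if "b \<in> E" for n b y
    using M[OF that, of n y] mult_right_mono[of M M' "norm y"] by (simp add: M'_def)
  have M'0: "0 \<le> M'" by (simp add: M'_def)
  define k where "k = (\<Sum>b\<in>E. C b * M')"
  have k: "0 \<le> k" unfolding k_def using C M'0 by (intro sum_nonneg mult_nonneg_nonneg)
  obtain D where D: "0 < D" and conv': "\<forall>(y :: int \<Rightarrow> int \<Rightarrow> 'x) Z (x :: int \<Rightarrow> 'x).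
      (\<forall>i. y i \<in> lp p \<and> lp_norm p (y i) \<le> Z) \<longrightarrow>
      (\<forall>n. norm (x n) \<le> k * (\<Sum>\<^sub>\<infinity>i. Q ^ nat \<bar>i\<bar> * norm (y i n))) \<longrightarrow>
      x \<in> lp p \<and> lp_norm p x \<le> D * Z"
    using lp_norm_geometric_convolution[OF Q p k] by auto
  show ?thesis
    unfolding shadowing_property_def
  proof (intro exI[of _ D] conjI D allI impI)
    fix z :: "int \<Rightarrow> int \<Rightarrow> 'x"
    assume "bounded_seq_in (lp p) (lp_norm p) z"
    then have z_lp: "\<And>t. z t \<in> lp p" and z_bdd: "bdd_above (range (\<lambda>t. lp_norm p (z t)))"
      by (auto simp: bounded_seq_in_def)
    define Z where "Z = (SUP t. lp_norm p (z t))"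
    have z_le: "lp_norm p (z t) \<le> Z" for t
      unfolding Z_def using z_bdd by (intro cSUP_upper) auto
    define c where "c b d j = coord j b (z (d - 1 - j) j)" for b d j
    define x where "x t n = (\<Sum>b\<in>E. cscale (green_solution (P b) (c b (t + n)) n) (orbit S n b))" for t n
    have green: "green_solution (P b) (c b d) n - green_solution (P b) (c b d) (n + 1) = c b d n"
      "norm (green_solution (P b) (c b d) n) * norm (orbit S n b)
        \<le> C b * (\<Sum>\<^sub>\<infinity>i. Q ^ nat \<bar>i\<bar> * (M' * norm (z (d - 1 - (n + i)) (n + i))))"
      if b: "b \<in> E" for b d n
    proof -
      have pos: "0 < norm (orbit S j b)" for j using orbit_nonzero[OF b] by simp
      have c_le: "norm (c b d j) * norm (orbit S j b) \<le> M' * norm (z (d - 1 - j) j)" for j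
        unfolding c_def by (rule M'[OF b])
      have s_le: "M' * norm (z (d - 1 - j) j) \<le> M' * Z" for j
        using norm_le_lp_norm[OF p z_lp] z_le M'0 by (intro mult_left_mono) (auto intro: order_trans)
      show "green_solution (P b) (c b d) n - green_solution (P b) (c b d) (n + 1) = c b d n"
        by (rule green_solution_solves(1)[OF pos Q C[OF b] kernel_Q[OF b] c_le s_le])
      show "norm (green_solution (P b) (c b d) n) * norm (orbit S n b)
        \<le> C b * (\<Sum>\<^sub>\<infinity>i. Q ^ nat \<bar>i\<bar> * (M' * norm (z (d - 1 - (n + i)) (n + i))))"
        by (rule green_solution_solves(2)[OF pos Q C[OF b] kernel_Q[OF b] c_le s_le])
    qed
    have x_bound: "x t \<in> lp p \<and> lp_norm p (x t) \<le> D * Z" for t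
    proof (rule conv'[rule_format, where y = "\<lambda>i n. z (t - 1 - i) (n + i)"])
      show "(\<lambda>n. z (t - 1 - i) (n + i)) \<in> lp p \<and> lp_norm p (\<lambda>n. z (t - 1 - i) (n + i)) \<le> Z" for i
        using lp_shift[OF z_lp] z_le by simp
      fix n
      have "norm (x t n) \<le> (\<Sum>b\<in>E. norm (green_solution (P b) (c b (t + n)) n) * norm (orbit S n b))"
        unfolding x_def by (rule order_trans[OF norm_sum]) (simp add: norm_cscale)
      also have "\<dots> \<le> (\<Sum>b\<in>E. C b * (\<Sum>\<^sub>\<infinity>i. Q ^ nat \<bar>i\<bar> * (M' * norm (z (t + n - 1 - (n + i)) (n + i)))))"
        by (intro sum_mono green(2))
      also have "\<dots> = (\<Sum>b\<in>E. C b * (\<Sum>\<^sub>\<infinity>i. M' * (Q ^ nat \<bar>i\<bar> * norm (z (t - 1 - i) (n + i)))))"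
        by (simp add: algebra_simps)
      also have "\<dots> = k * (\<Sum>\<^sub>\<infinity>i. Q ^ nat \<bar>i\<bar> * norm (z (t - 1 - i) (n + i)))"
        by (simp add: infsum_cmult_right' k_def sum_distrib_right mult.assoc)
      finally show "norm (x t n) \<le> k * (\<Sum>\<^sub>\<infinity>i. Q ^ nat \<bar>i\<bar> * norm (z (t - 1 - i) (n + i)))" .
    qed
    have x_eq: "x (t + 1) - shift_op S (x t) = z t" for t
    proof
      fix n
      interpret S: Vector_Spaces.linear cscale cscale "S (n + 1)" by (rule linear_S)
      have "S (n + 1) (x t (n + 1))
          = (\<Sum>b\<in>E. cscale (green_solution (P b) (c b (t + n + 1)) (n + 1)) (orbit S n b))"
        by (simp add: x_def S.sum S.scale S_orbit add.assoc)
      then have "(x (t + 1) - shift_op S (x t)) n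
          = (\<Sum>b\<in>E. cscale (green_solution (P b) (c b (t + n + 1)) n
              - green_solution (P b) (c b (t + n + 1)) (n + 1)) (orbit S n b))"
        by (simp add: shift_op_def x_def scale_left_diff_distrib sum_subtractf add.commute add.left_commute)
      also have "\<dots> = (\<Sum>b\<in>E. cscale (coord n b (z t n)) (orbit S n b))"
        by (intro sum.cong refl) (simp add: green(1), simp add: c_def)
      also have "\<dots> = z t n" by (rule sum_coord)
      finally show "(x (t + 1) - shift_op S (x t)) n = z t n" .
    qed
    have "bounded_seq_in (lp p) (lp_norm p) x"
      unfolding bounded_seq_in_def using x_bound by (auto intro!: bdd_aboveI2)
    moreover have "(SUP t. lp_norm p (x t)) \<le> D * Z"
      using x_bound by (intro cSUP_least) auto
    ultimately show "\<exists>x. bounded_seq_in (lp p) (lp_norm p) x \<and>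
        (\<forall>n. x (n + 1) - shift_op S (x n) = z n) \<and>
        (SUP n. lp_norm p (x n)) \<le> D * (SUP n. lp_norm p (z n))"
      using x_eq unfolding Z_def by blast
  qed
qed

text \<open>
  The error at time \<open>t\<close> is the unit vector along the orbit of \<open>b\<close> at the entry \<open>-1 - t\<close>. All these errors act on the single
  equation \<open>d = 0\<close>, always with the same sign, so that they add up along any window, while the solution
  at the two ends of the window is bounded by \<open>1 / norm (orbit S n b)\<close> up to a constant.
\<close>

lemma sum_le_endpoints_if_shadowing:
  assumes p: "0 < p"
    and M: "\<And>n b y. b \<in> E \<Longrightarrow> norm (coord n b y) * norm (orbit S n b) \<le> M * norm y"
    and shadow: "shadowing_property (lp p) (lp_norm p) (shift_op S)"
    and b: "b \<in> E"
  shows "\<exists>K. \<forall>m n. m \<le> n \<longrightarrow> (\<Sum>j\<in>{m..n}. 1 / norm (orbit S j b))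
    \<le> K * (1 / norm (orbit S m b) + 1 / norm (orbit S n b))"
proof -
  define A where "A n = 1 / norm (orbit S n b)" for n
  have A_pos: "0 < A n" for n using orbit_nonzero[OF b] by (simp add: A_def)
  define z where "z t m = (if m = - 1 - t then e_vec S m b else 0)" for t m :: int
  have z_eq: "z t = (\<lambda>m. if m = - 1 - t then e_vec S (- 1 - t) b else 0)" for t
    by (auto simp: z_def)
  have "norm (e_vec S n b) = 1" for n
    using orbit_nonzero[OF b] by (simp add: e_vec_eq_orbit)
  then have z_lp: "z t \<in> lp p" and z_norm: "lp_norm p (z t) = 1" for t
    unfolding z_eq using lp_single[OF p, of "- 1 - t" "e_vec S (- 1 - t) b"] by simp_all
  have "bounded_seq_in (lp p) (lp_norm p) z"
    unfolding bounded_seq_in_def using z_lp by (auto simp: z_norm)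
  then obtain K x where K: "0 < K" and x: "bounded_seq_in (lp p) (lp_norm p) x"
    and eq: "\<And>t. x (t + 1) - shift_op S (x t) = z t"
    and sup: "(SUP t. lp_norm p (x t)) \<le> K * (SUP t. lp_norm p (z t))"
    using shadow unfolding shadowing_property_def by blast
  have x_norm: "norm (x t n) \<le> K" for t n
  proof -
    have "norm (x t n) \<le> lp_norm p (x t)"
      using x by (intro norm_le_lp_norm p) (auto simp: bounded_seq_in_def)
    also have "\<dots> \<le> (SUP t. lp_norm p (x t))"
      using x by (intro cSUP_upper) (auto simp: bounded_seq_in_def)
    finally show ?thesis using sup by (simp add: z_norm)
  qed
  define M' where "M' = max M 0"
  define f where "f n = coord n b (x (- n) n)" for n
  have f_bound: "norm (f n) \<le> M' * K * A n" for n
  proof -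
    have "norm (f n) * norm (orbit S n b) \<le> M * norm (x (- n) n)" unfolding f_def by (rule M[OF b])
    also have "\<dots> \<le> M' * K" using x_norm[of "- n" n] by (intro mult_mono) (auto simp: M'_def)
    finally show ?thesis using orbit_nonzero[OF b, of n] by (simp add: A_def field_simps)
  qed
  have step: "f n - f (n + 1) = of_real (A n)" for n
  proof -
    have "x (- n) n - S (n + 1) (x (- (n + 1)) (n + 1)) = e_vec S n b"
      using fun_cong[OF eq[of "- (n + 1)"], of n] by (simp add: shift_op_def z_def)
    then have "coord n b (x (- n) n) - coord n b (S (n + 1) (x (- (n + 1)) (n + 1))) = of_real (A n)"
      using b by (simp add: coord_e_vec A_def flip: coord_diff)
    then show ?thesis using coord_S[of "n + 1" b] by (simp add: f_def)
  qed
  have telescope: "f m - f (m + int n) = of_real (\<Sum>i<n. A (m + int i))" for m n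
  proof (induction n)
    case (Suc n)
    have "f m - f (m + int (Suc n)) = (f m - f (m + int n)) + (f (m + int n) - f (m + int n + 1))"
      by (simp add: algebra_simps)
    then show ?case using Suc step[of "m + int n"] by simp
  qed simp
  have "(\<Sum>j\<in>{m..n}. A j) \<le> (M' * K + 1) * (A m + A n)" if "m \<le> n" for m n
  proof -
    define l where "l = nat (n - m)"
    have n: "n = m + int l" using that by (simp add: l_def)
    have "(\<Sum>i<l. A (m + int i)) \<le> norm (of_real (\<Sum>i<l. A (m + int i)) :: 'k)"
      by (simp add: abs_ge_self del: of_real_sum)
    also have "\<dots> \<le> norm (f m) + norm (f n)"
      unfolding telescope[symmetric] n by (rule norm_triangle_ineq4)
    also have "\<dots> \<le> M' * K * (A m + A n)"
      using f_bound[of m] f_bound[of n] by (simp add: algebra_simps)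
    finally have "(\<Sum>i<l. A (m + int i)) + A n \<le> (M' * K + 1) * (A m + A n)"
      using A_pos[of m] by (simp add: algebra_simps)
    moreover have "(\<Sum>j\<in>{m..n}. A j) = (\<Sum>i<l. A (m + int i)) + A n"
      unfolding n sum_int_atLeastAtMost_shift by (simp flip: lessThan_Suc_atMost)
    ultimately show ?thesis by simp
  qed
  then show ?thesis unfolding A_def by blast
qed

end

theorem corollary2p17:
  fixes p :: real
    and cscale :: "'k::real_or_complex \<Rightarrow> 'x::real_normed_vector \<Rightarrow> 'x"
    and ip :: "'x \<Rightarrow> 'x \<Rightarrow> 'k"
    and S :: "int \<Rightarrow> 'x \<Rightarrow> 'x"
    and E :: "'x set"
  assumes "1 \<le> p"
    and "fin_dim_hilbert_space cscale ip"
    and "\<And>n. Vector_Spaces.linear cscale cscale (S n)"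
    and "\<And>n. bij (S n)"
    and "\<exists>C\<^sub>0>0. \<forall>n. onorm (S n) < C\<^sub>0 \<and> onorm (inv (S n)) < C\<^sub>0"
    and "is_basis cscale E"
    and "has_bounded_projections cscale S E"
  shows "shadowing_property (lp p) (lp_norm p) (shift_op S) \<longleftrightarrow>
    (\<forall>x\<in>E. condA S x \<or> condB S x \<or> condC S x)"
proof -
  obtain C\<^sub>0 where C\<^sub>0: "\<And>n. onorm (S n) < C\<^sub>0" "\<And>n. onorm (inv (S n)) < C\<^sub>0"
    using assms(5) by blast
  interpret invertible_operator_sequence cscale ip S E C\<^sub>0
    using assms C\<^sub>0 by (intro invertible_operator_sequence.intro invertible_operator_sequence_axioms.intro)
      (auto intro: less_imp_le)
  obtain M where "\<And>n b. b \<in> E \<Longrightarrow> onorm (basis_proj cscale (e_vec S n ` E) (e_vec S n b)) \<le> M"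
    using assms(7) unfolding has_bounded_projections_def by blast
  note M = coord_bound[OF this]
  have p: "0 < p" using assms(1) by simp
  have conditions: "condA S b \<or> condB S b \<or> condC S b \<longleftrightarrow>
      exp_increasing_on UNIV (\<lambda>n. norm (orbit S n b)) \<or>
      exp_decreasing_on UNIV (\<lambda>n. norm (orbit S n b)) \<or>
      exp_increasing_on {..-1} (\<lambda>n. norm (orbit S n b)) \<and>
      exp_decreasing_on {0..} (\<lambda>n. norm (orbit S n b))" if "b \<in> E" for b
    using bounded_ratios_orbit[OF that] by (simp only: condA_iff condB_iff condC_iff)
  show ?thesis
  proof
    assume shadow: "shadowing_property (lp p) (lp_norm p) (shift_op S)"
    show "\<forall>x\<in>E. condA S x \<or> condB S x \<or> condC S x"
    proof
      fix b assume b: "b \<in> E"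
      have pos: "0 < norm (orbit S j b)" for j using orbit_nonzero[OF b] by simp
      obtain K where K: "\<And>m n. m \<le> n \<Longrightarrow> (\<Sum>j\<in>{m..n}. 1 / norm (orbit S j b))
          \<le> K * (1 / norm (orbit S m b) + 1 / norm (orbit S n b))"
        using sum_le_endpoints_if_shadowing[OF p M shadow b] by blast
      have "exp_decreasing_on UNIV (\<lambda>j. 1 / norm (orbit S j b)) \<or>
          exp_increasing_on UNIV (\<lambda>j. 1 / norm (orbit S j b)) \<or>
          exp_decreasing_on {..-1} (\<lambda>j. 1 / norm (orbit S j b)) \<and>
          exp_increasing_on {0..} (\<lambda>j. 1 / norm (orbit S j b))"
        by (rule exponential_trichotomy[OF _ K]) (use pos in auto)
      then show "condA S b \<or> condB S b \<or> condC S b"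
        unfolding conditions[OF b] exp_decreasing_inverse[of "\<lambda>j. norm (orbit S j b)", OF pos]
          exp_increasing_inverse[of "\<lambda>j. norm (orbit S j b)", OF pos] .
    qed
  next
    assume "\<forall>x\<in>E. condA S x \<or> condB S x \<or> condC S x"
    then show "shadowing_property (lp p) (lp_norm p) (shift_op S)"
      by (intro shadowing_if_exponential[OF p M]) (simp_all add: conditions[symmetric])
  qed
qed

end
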